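(* Let $(M,\widetilde B)$ be a strict root of unity quantum seed with respect to a skew-symmetric integer matrix $\Lambda$, $(M_q,\widetilde B)$ the associated quantum seed, and $\mathrm{inv}\subseteq[1,N]\setminus\mathrm{ex}$. If $$\mathcal A_q(M_q,\widetilde B,\mathrm{inv})\cap\big(\Phi_\ell(q^{1/2})\,\mathcal T_q(M_q)_\ge\big)=\Phi_\ell(q^{1/2})\,\mathcal A_q(M_q,\widetilde B,\mathrm{inv}),$$ then $\mathcal A_q(M_q,\widetilde B,\mathrm{inv})/(\Phi_\ell(q^{1/2}))\cong\mathcal A_\varepsilon(M,\widetilde B,\mathrm{inv})$, and the specialization map $\eta_\varepsilon:\mathcal A_q(M_q,\widetilde B,\mathrm{inv})\to\mathcal A_q(M_q,\widetilde B,\mathrm{inv})/(\Phi_\ell(q^{1/2}))$ is the restriction to $\mathcal A_q(M_q,\widetilde B,\mathrm{inv})$ of the specialization map $\kappa_\varepsilon:\mathcal T_q(M_q)_\ge\to\mathcal T_\varepsilon(M)_\ge$.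
   Context: Root of unity setting: $\ell$ a positive integer, $\mathbb Z_\ell=\mathbb Z/\ell\mathbb Z$, $\varepsilon^{1/2}\in\mathbb C$ a primitive $\ell$-th root of unity, $\mathcal A^{1/2}_\varepsilon=\mathbb Z[\varepsilon^{1/2}]$, $\varepsilon^{a/2}=(\varepsilon^{1/2})^a$; $\overline C$ = reduction mod $\ell$; $e_1,\dots,e_N$ standard basis. For skew-symmetric $\Lambda:\mathbb Z^N\times\mathbb Z^N\to\mathbb Z_\ell$, $\mathcal T_\varepsilon(\Lambda)$ has $\mathcal A^{1/2}_\varepsilon$-basis $X^f$ with $X^fX^g=\varepsilon^{\Lambda(f,g)/2}X^{f+g}$; a root of unity toric frame of a division algebra $\mathcal F$ over $\mathbb Q(\varepsilon^{1/2})$ is $M:\mathbb Z^N\to\mathcal F$ with $f\mapsto M(f)$ extending to an injective algebra map from some (unique) $\mathcal T_\varepsilon(\Lambda_M)$ whose image $\mathcal T_\varepsilon(M)$ generates $\mathcal F$ as a skew field. Fix $\mathrm{ex}\subseteq[1,N]$; $\widetilde B=(b_{ij})$ integer, rows $[1,N]$, columns $\mathrm{ex}$, principal part $B$, columns $b^k$. $\ell$-compatibility w.r.t. $D=\mathrm{diag}(d_j)_{j\in\mathrm{ex}}$ ($d_j>0$): $DB$ skew-symmetric and $\sum_k\overline b_{kj}(\Lambda_M)_{ki}=\delta_{ij}\overline d_j$ mod $\ell$; seeds are such pairs $(M,\widetilde B)$; mutation $\mu_k$: $\mu_k(\widetilde B)$ has entries $-b_{ij}$ if $i=k$ or $j=k$,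 else $b_{ij}+(|b_{ik}|b_{kj}+b_{ik}|b_{kj}|)/2$; $\mu_k(M)$ is the frame with matrix $\overline E^\top\Lambda_M\overline E$ ($e_{ij}=\delta_{ij}$ for $j\ne k$, $e_{kk}=-1$, $e_{ik}=\max(0,-b_{ik})$), $\mu_k(M)(e_j)=M(e_j)$ ($j\neq k$), $\mu_k(M)(e_k)=M(-e_k+[b^k]_+)+M(-e_k-[b^k]_-)$ ($[b]_\pm$ keeps entries with $\pm b_i\ge0$). $\mathcal A_\varepsilon(M,\widetilde B,\mathrm{inv})$ is the $\mathcal A^{1/2}_\varepsilon$-algebra generated by cluster variables $M'(e_i)$ of all mutation-equivalent seeds and $M(e_j)^{-1}$, $j\in\mathrm{inv}$. Quantum setting: $\mathcal A^{1/2}_q=\mathbb Z[q^{\pm1/2}]$; $\mathcal T_q(\Lambda)$ for skew-symmetric integer $\Lambda$ has basis $X^f$ with $X^fX^g=q^{\Lambda(f,g)/2}X^{f+g}$; toric frames $M_q$, compatibility ($\sum_kb_{kj}\lambda_{ki}=\delta_{ij}d_j$), quantum seeds, mutations and $\mathcal A_q(M_q,\widetilde B,\mathrm{inv})$ are defined analogously over $\mathcal A^{1/2}_q$. Mixed tori: $\mathcal T_q(M_q)_\ge$ (resp. $\mathcal T_\varepsilon(M)_\ge$) is the subalgebra generated by $M_q(e_i)$, $i\in[1,N]$, and $M_q(e_j)^{-1}$, $j\in\mathrm{ex}\sqcup\mathrm{inv}$ (resp. same with $M$). Strictness: $(M,\widetilde B)$ is strict w.r.t. skew-symmetric $\Lambda\in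 M_N(\mathbb Z)$ if $\overline\Lambda=\Lambda_M$ and $(\Lambda,\widetilde B)$ is compatible w.r.t. the same $D$; the associated quantum seed is $(M_q,\widetilde B)$ in $\mathrm{Fract}(\mathcal T_q(\Lambda))$ with $M_q(f)=X^f$. $\Phi_\ell$ is the $\ell$-th cyclotomic polynomial; $\kappa_\varepsilon:\mathcal T_q(M_q)\to\mathcal T_\varepsilon(M)$ is the ring surjection with $q^{1/2}\mapsto\varepsilon^{1/2}$, $M_q(f)\mapsto M(f)$, with kernel $(\Phi_\ell(q^{1/2}))$; it restricts to $\kappa_\varepsilon:\mathcal T_q(M_q)_\ge\to\mathcal T_\varepsilon(M)_\ge\cong\mathcal T_q(M_q)_\ge/(\Phi_\ell(q^{1/2}))$. By the quantum Laurent phenomenon $\mathcal A_q(M_q,\widetilde B,\mathrm{inv})\subseteq\mathcal T_q(M_q)_\ge$. *)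

theory Defs
  imports Complex_Main "HOL-Computational_Algebra.Polynomial"
begin

text \<open>Index set [1,N] is a finite type 'n; Z^N is 'n => int.\<close>

definition unitv :: "'n \<Rightarrow> 'n \<Rightarrow> int" where
  "unitv j = (\<lambda>i. if i = j then 1 else 0)"

definition bil :: "('n::finite \<Rightarrow> 'n \<Rightarrow> int) \<Rightarrow> ('n \<Rightarrow> int) \<Rightarrow> ('n \<Rightarrow> int) \<Rightarrow> int" where
  "bil L f g = (\<Sum>i\<in>UNIV. \<Sum>j\<in>UNIV. f i * L i j * g j)"

text \<open>Multiplicative relation of a toric frame: M(f) M(g) = s(Lambda(f,g)) M(f+g), where s a is the
  image of (q^{1/2})^a resp. (eps^{1/2})^a.\<close>
definition mult_rel :: "(int \<Rightarrow> 'k::ring_1) \<Rightarrow> ('n::finite \<Rightarrow> 'n \<Rightarrow> int) \<Rightarrow> (('n \<Rightarrow> int) \<Rightarrow> 'k) \<Rightarrow> bool" where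
  "mult_rel s L M \<longleftrightarrow> M (\<lambda>_. 0) = 1 \<and> (\<forall>f g. M f * M g = s (bil L f g) * M (\<lambda>i. f i + g i))"

definition mut_B :: "('n \<Rightarrow> 'n \<Rightarrow> int) \<Rightarrow> 'n \<Rightarrow> 'n \<Rightarrow> 'n \<Rightarrow> int" where
  "mut_B B k = (\<lambda>i j. if i = k \<or> j = k then - B i j
      else B i j + (\<bar>B i k\<bar> * B k j + B i k * \<bar>B k j\<bar>) div 2)"

definition mut_E :: "('n \<Rightarrow> 'n \<Rightarrow> int) \<Rightarrow> 'n \<Rightarrow> 'n \<Rightarrow> 'n \<Rightarrow> int" where
  "mut_E B k = (\<lambda>i j. if j \<noteq> k then (if i = j then 1 else 0)
      else if i = k then -1 else max 0 (- B i k))"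

definition mut_L :: "('n::finite \<Rightarrow> 'n \<Rightarrow> int) \<Rightarrow> ('n \<Rightarrow> 'n \<Rightarrow> int) \<Rightarrow> 'n \<Rightarrow> 'n \<Rightarrow> 'n \<Rightarrow> int" where
  "mut_L L B k = (\<lambda>i j. \<Sum>a\<in>UNIV. \<Sum>b\<in>UNIV. mut_E B k a i * L a b * mut_E B k b j)"

definition mut_M :: "(int \<Rightarrow> 'k::ring_1) \<Rightarrow> ('n::finite \<Rightarrow> 'n \<Rightarrow> int) \<Rightarrow> ('n \<Rightarrow> 'n \<Rightarrow> int) \<Rightarrow> 'n
     \<Rightarrow> (('n \<Rightarrow> int) \<Rightarrow> 'k) \<Rightarrow> (('n \<Rightarrow> int) \<Rightarrow> 'k)" where
  "mut_M s L B k M = (THE M'. mult_rel s (mut_L L B k) M'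
      \<and> (\<forall>j. j \<noteq> k \<longrightarrow> M' (unitv j) = M (unitv j))
      \<and> M' (unitv k) = M (\<lambda>i. - unitv k i + max (B i k) 0) + M (\<lambda>i. - unitv k i - min (B i k) 0))"

inductive_set seeds :: "(int \<Rightarrow> 'k::ring_1) \<Rightarrow> 'n::finite set \<Rightarrow> (('n \<Rightarrow> int) \<Rightarrow> 'k)
     \<Rightarrow> ('n \<Rightarrow> 'n \<Rightarrow> int) \<Rightarrow> ('n \<Rightarrow> 'n \<Rightarrow> int)
     \<Rightarrow> ((('n \<Rightarrow> int) \<Rightarrow> 'k) \<times> ('n \<Rightarrow> 'n \<Rightarrow> int) \<times> ('n \<Rightarrow> 'n \<Rightarrow> int)) set"
  for s ex M0 L0 B0 where
  init: "(M0, L0, B0) \<in> seeds s ex M0 L0 B0"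
| step: "(M, L, B) \<in> seeds s ex M0 L0 B0 \<Longrightarrow> k \<in> ex
          \<Longrightarrow> (mut_M s L B k M, mut_L L B k, mut_B B k) \<in> seeds s ex M0 L0 B0"

inductive_set gen_alg :: "'k::ring_1 set \<Rightarrow> 'k set \<Rightarrow> 'k set" for S G where
  scal: "x \<in> S \<Longrightarrow> x \<in> gen_alg S G"
| gen: "x \<in> G \<Longrightarrow> x \<in> gen_alg S G"
| add: "x \<in> gen_alg S G \<Longrightarrow> y \<in> gen_alg S G \<Longrightarrow> x + y \<in> gen_alg S G"
| mult: "x \<in> gen_alg S G \<Longrightarrow> y \<in> gen_alg S G \<Longrightarrow> x * y \<in> gen_alg S G"

inductive_set gen_divring :: "'k::division_ring set \<Rightarrow> 'k set" for G where
  gen: "x \<in> G \<Longrightarrow> x \<in> gen_divring G"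
| one: "1 \<in> gen_divring G"
| neg: "x \<in> gen_divring G \<Longrightarrow> - x \<in> gen_divring G"
| add: "x \<in> gen_divring G \<Longrightarrow> y \<in> gen_divring G \<Longrightarrow> x + y \<in> gen_divring G"
| mult: "x \<in> gen_divring G \<Longrightarrow> y \<in> gen_divring G \<Longrightarrow> x * y \<in> gen_divring G"
| inv: "x \<in> gen_divring G \<Longrightarrow> inverse x \<in> gen_divring G"

definition cluster_alg :: "'k::division_ring set \<Rightarrow> (int \<Rightarrow> 'k) \<Rightarrow> 'n::finite set \<Rightarrow> 'n set
     \<Rightarrow> (('n \<Rightarrow> int) \<Rightarrow> 'k) \<Rightarrow> ('n \<Rightarrow> 'n \<Rightarrow> int) \<Rightarrow> ('n \<Rightarrow> 'n \<Rightarrow> int) \<Rightarrow> 'k set" where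
  "cluster_alg S s ex invs M0 L0 B0 = gen_alg S
     ({M' (unitv i) | M' L' B' i. (M', L', B') \<in> seeds s ex M0 L0 B0}
      \<union> (\<lambda>j. inverse (M0 (unitv j))) ` invs)"

text \<open>Image of A_q = Z[q^{+-1/2}] in K, where t is the image of q^{1/2}.\<close>
definition Aq_scal :: "'k::division_ring \<Rightarrow> 'k set" where
  "Aq_scal t = {x. \<exists>n::int \<Rightarrow> int. finite {a. n a \<noteq> 0}
       \<and> x = (\<Sum>a\<in>{a. n a \<noteq> 0}. of_int (n a) * t powi a)}"

text \<open>A_eps = Z[eps^{1/2}] as a subring of C, w = eps^{1/2}.\<close>
definition Aeps :: "complex \<Rightarrow> complex set" where
  "Aeps w = {x. \<exists>(n::nat \<Rightarrow> int) m. x = (\<Sum>a<m. of_int (n a) * w ^ a)}"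

text \<open>Quantum toric frame with matrix L in the division ring K (an A_q-algebra via the central t).\<close>
definition qframe :: "'k::division_ring \<Rightarrow> ('n::finite \<Rightarrow> 'n \<Rightarrow> int) \<Rightarrow> (('n \<Rightarrow> int) \<Rightarrow> 'k) \<Rightarrow> bool" where
  "qframe t L M \<longleftrightarrow> (\<forall>x. t * x = x * t)
     \<and> mult_rel (\<lambda>a. t powi a) L M
     \<and> (\<forall>c :: int \<Rightarrow> ('n \<Rightarrow> int) \<Rightarrow> int. finite {(a, f). c a f \<noteq> 0} \<longrightarrow>
          (\<Sum>(a, f)\<in>{(a, f). c a f \<noteq> 0}. of_int (c a f) * t powi a * M f) = 0 \<longrightarrow>
          (\<forall>a f. c a f = 0))
     \<and> gen_divring ({t} \<union> range M) = UNIV"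

text \<open>Root of unity toric frame with matrix L mod l in the division algebra F over Q(eps^{1/2});
  iota gives the A_eps-algebra structure.\<close>
definition eframe :: "(complex \<Rightarrow> 'f::division_ring) \<Rightarrow> complex \<Rightarrow> ('n::finite \<Rightarrow> 'n \<Rightarrow> int)
     \<Rightarrow> (('n \<Rightarrow> int) \<Rightarrow> 'f) \<Rightarrow> bool" where
  "eframe \<iota> w L M \<longleftrightarrow> \<iota> 1 = 1
     \<and> (\<forall>x\<in>Aeps w. \<forall>y\<in>Aeps w. \<iota> (x + y) = \<iota> x + \<iota> y \<and> \<iota> (x * y) = \<iota> x * \<iota> y)
     \<and> (\<forall>x\<in>Aeps w. \<forall>y. \<iota> x * y = y * \<iota> x)
     \<and> mult_rel (\<lambda>a. \<iota> (w powi a)) L M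
     \<and> (\<forall>c :: ('n \<Rightarrow> int) \<Rightarrow> complex. finite {f. c f \<noteq> 0} \<longrightarrow> (\<forall>f. c f \<in> Aeps w) \<longrightarrow>
          (\<Sum>f\<in>{f. c f \<noteq> 0}. \<iota> (c f) * M f) = 0 \<longrightarrow> (\<forall>f. c f = 0))
     \<and> gen_divring (\<iota> ` Aeps w \<union> range M) = UNIV"

definition compat :: "('n::finite \<Rightarrow> 'n \<Rightarrow> int) \<Rightarrow> ('n \<Rightarrow> 'n \<Rightarrow> int) \<Rightarrow> ('n \<Rightarrow> int) \<Rightarrow> 'n set \<Rightarrow> bool" where
  "compat L B D ex \<longleftrightarrow> (\<forall>j\<in>ex. D j > 0)
     \<and> (\<forall>i\<in>ex. \<forall>j\<in>ex. D i * B i j = - (D j * B j i))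
     \<and> (\<forall>i. \<forall>j\<in>ex. (\<Sum>k\<in>UNIV. B k j * L k i) = (if i = j then D j else 0))"

definition ell_compat :: "nat \<Rightarrow> ('n::finite \<Rightarrow> 'n \<Rightarrow> int) \<Rightarrow> ('n \<Rightarrow> 'n \<Rightarrow> int) \<Rightarrow> ('n \<Rightarrow> int) \<Rightarrow> 'n set \<Rightarrow> bool" where
  "ell_compat l L B D ex \<longleftrightarrow> (\<forall>j\<in>ex. D j > 0)
     \<and> (\<forall>i\<in>ex. \<forall>j\<in>ex. D i * B i j = - (D j * B j i))
     \<and> (\<forall>i. \<forall>j\<in>ex. (\<Sum>k\<in>UNIV. B k j * L k i) mod int l = (if i = j then D j else 0) mod int l)"

definition Tq_ge :: "'k::division_ring \<Rightarrow> 'n set \<Rightarrow> 'n set \<Rightarrow> (('n \<Rightarrow> int) \<Rightarrow> 'k) \<Rightarrow> 'k set" where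
  "Tq_ge t ex invs M = gen_alg (Aq_scal t)
     (range (\<lambda>i. M (unitv i)) \<union> (\<lambda>j. inverse (M (unitv j))) ` (ex \<union> invs))"

definition kappa :: "'k::division_ring \<Rightarrow> (complex \<Rightarrow> 'f::division_ring) \<Rightarrow> complex
     \<Rightarrow> (('n \<Rightarrow> int) \<Rightarrow> 'k) \<Rightarrow> (('n \<Rightarrow> int) \<Rightarrow> 'f) \<Rightarrow> 'k \<Rightarrow> 'f" where
  "kappa t \<iota> w Mq M x = (THE y. \<exists>c :: int \<Rightarrow> ('n \<Rightarrow> int) \<Rightarrow> int. finite {(a, f). c a f \<noteq> 0}
      \<and> x = (\<Sum>(a, f)\<in>{(a, f). c a f \<noteq> 0}. of_int (c a f) * t powi a * Mq f)
      \<and> y = (\<Sum>(a, f)\<in>{(a, f). c a f \<noteq> 0}. \<iota> (of_int (c a f) * w powi a) * M f))"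

definition cyclo :: "nat \<Rightarrow> int poly" where
  "cyclo l = (THE p. map_poly of_int p
      = (\<Prod>k\<in>{k\<in>{1..l}. coprime k l}. [:- cis (2 * pi * real k / real l), 1:]))"

definition eval_int_poly :: "int poly \<Rightarrow> 'k::ring_1 \<Rightarrow> 'k" where
  "eval_int_poly p x = (\<Sum>i\<le>degree p. of_int (coeff p i) * x ^ i)"

end

theory Submission
  imports Defs "HOL-Computational_Algebra.Computational_Algebra" "HOL-Number_Theory.Cong"
begin

text \<open>
  The hypothesis contains \<open>\<Phi>\<^sub>l A\<^sub>q \<subseteq> \<Phi>\<^sub>l T\<^sub>\<ge>\<close>; cancelling \<open>\<Phi>\<^sub>l\<close> gives the Laurent phenomenon
  \<open>A\<^sub>q \<subseteq> T\<^sub>\<ge>\<close>, so \<open>\<kappa>\<close> is a ring homomorphism on \<open>A\<^sub>q\<close>. It matches the cluster variables of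
  the two seed trees: if a mutation replaces \<open>x\<close> by \<open>x'\<close>, then \<open>x' x\<close> is a fixed polynomial
  expression in the other variables of the seed, and \<open>x\<close> can be cancelled in the division ring on
  the root of unity side. Hence \<open>\<kappa>\<close> maps generators onto generators. An element of \<open>T\<^sub>\<ge>\<close> is
  killed by \<open>\<kappa>\<close> iff all its coefficients, Laurent polynomials in \<open>q\<^sup>1\<^sup>/\<^sup>2\<close>, vanish at
  \<open>\<epsilon>\<^sup>1\<^sup>/\<^sup>2\<close>, that is, iff they are divisible by \<open>\<Phi>\<^sub>l\<close>, the minimal polynomial of a primitive
  \<open>l\<close>-th root of unity. So the kernel on \<open>A\<^sub>q\<close> is \<open>A\<^sub>q \<inter> \<Phi>\<^sub>l T\<^sub>\<ge> = \<Phi>\<^sub>l A\<^sub>q\<close>.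
\<close>

section \<open>Cyclotomic polynomials\<close>

text \<open>Two of the notions are definite descriptions, and this shapes the proof.
  \<open>cyclo\<close> presupposes that a product of complex linear factors has integer
  coefficients; so a monic minimal polynomial over the integers is constructed, and its roots are
  identified afterwards. \<open>mut_M\<close> presupposes that exactly one frame has the prescribed
  values: existence needs a nonzero new variable, hence linear independence of the current frame,
  and independence must be proved again for the mutated frame before the next mutation.

  The map \<kappa> does not extend to the skew field: the cyclotomic element is invertible there and
  would have to go to 0. So no frame is transported as a whole, only the variables of each seed.
  Strictness provides one integer matrix for both sides; seeds reached by the same mutations
  therefore carry the same matrices and the same compatibility.\<close>

lemma eval_int_poly_0 [simp]: "eval_int_poly 0 x = 0"
  by (simp add: eval_int_poly_def)

lemma eval_int_poly_pCons [simp]: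
  "eval_int_poly (pCons a p) x = of_int a + x * eval_int_poly p x"
proof (cases "p = 0")
  case True
  then show ?thesis by (simp add: eval_int_poly_def)
next
  case False
  have "eval_int_poly (pCons a p) x = (\<Sum>i\<le>Suc (degree p). of_int (coeff (pCons a p) i) * x ^ i)"
    using False by (simp add: eval_int_poly_def)
  also have "\<dots> = of_int a + (\<Sum>i\<le>degree p. of_int (coeff p i) * x ^ Suc i)"
    by (subst sum.atMost_Suc_shift) simp
  also have "(\<Sum>i\<le>degree p. of_int (coeff p i) * x ^ Suc i)
      = x * (\<Sum>i\<le>degree p. of_int (coeff p i) * x ^ i)"
    unfolding sum_distrib_left
  proof (rule sum.cong)
    fix i show "of_int (coeff p i) * x ^ Suc i = x * (of_int (coeff p i) * x ^ i)"
      by (metis mult.assoc mult_of_int_commute power_Suc)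
  qed simp
  finally show ?thesis by (simp add: eval_int_poly_def)
qed

lemma eval_int_poly_1 [simp]: "eval_int_poly 1 x = 1"
  by (simp add: one_pCons)

lemma eval_int_poly_add [simp]:
  "eval_int_poly (p + q) x = eval_int_poly p x + eval_int_poly q x"
  by (induction p q rule: poly_induct2) (simp_all add: algebra_simps)

lemma eval_int_poly_minus [simp]: "eval_int_poly (- p) x = - eval_int_poly p x"
  using eval_int_poly_add[of p "- p" x] by (simp add: eq_neg_iff_add_eq_0 add.commute)

lemma eval_int_poly_diff [simp]:
  "eval_int_poly (p - q) x = eval_int_poly p x - eval_int_poly q x"
  using eval_int_poly_add[of p "- q" x] by simp

lemma eval_int_poly_smult [simp]: "eval_int_poly (smult c p) x = of_int c * eval_int_poly p x"
proof (induction p)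
  case (pCons a p)
  have "x * (of_int c * eval_int_poly p x) = of_int c * (x * eval_int_poly p x)"
    by (metis mult.assoc mult_of_int_commute)
  then show ?case using pCons by (simp add: distrib_left)
qed simp

text \<open>The ring may be noncommutative: integer coefficients are central and a single element is
  substituted, so evaluation is still a ring homomorphism.\<close>

lemma eval_int_poly_mult [simp]:
  "eval_int_poly (p * q) x = eval_int_poly p x * eval_int_poly q x"
  by (induction p) (simp_all add: algebra_simps)

lemma eval_int_poly_power [simp]: "eval_int_poly (p ^ n) x = eval_int_poly p x ^ n"
  by (induction n) simp_all

lemma eval_int_poly_pcompose [simp]:
  "eval_int_poly (pcompose p q) x = eval_int_poly p (eval_int_poly q x)"
  by (induction p) (simp_all add: pcompose_pCons)

lemma eval_int_poly_monom [simp]: "eval_int_poly (monom a n) x = of_int a * x ^ n"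
proof (induction n)
  case (Suc n)
  have "x * (of_int a * x ^ n) = of_int a * (x * x ^ n)"
    by (metis mult.assoc mult_of_int_commute)
  then show ?case using Suc by (simp add: monom_Suc)
qed (simp add: monom_0)

lemma poly_map_poly_of_int:
  "poly (map_poly of_int p) (x :: 'a :: {comm_ring_1,ring_char_0}) = eval_int_poly p x"
  by (induction p) (simp_all add: map_poly_pCons)

section \<open>Minimal polynomials over the integers\<close>

text \<open>Gauss's lemma: contents multiply, so the content of the cofactor \<open>q\<close> is
  that of \<open>smult c g\<close>, a multiple of \<open>c\<close>, and \<open>c\<close> can be
  divided out of \<open>q\<close>.\<close>

lemma primitive_dvd_smultD:
  fixes f g :: "int poly"
  assumes "content f = 1" "c \<noteq> 0" "f dvd smult c g"
  shows "f dvd g"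
proof (cases "g = 0")
  case False
  obtain q where q: "smult c g = f * q" using assms(3) by auto
  have "content q = normalize c * content g"
    using arg_cong[OF q, of content] assms(1) by (simp add: content_mult)
  then have "c dvd content q" by simp
  then have "[:c:] dvd q" by (simp add: const_poly_dvd_iff_dvd_content)
  then obtain r where r: "q = smult c r" by (auto simp: dvd_def)
  have "smult c g = smult c (f * r)" using q r by simp
  then have "g = f * r" using assms(2) by (metis smult_cancel)
  then show ?thesis by simp
qed simp

text \<open>A vanishing polynomial of least degree, made primitive, divides every vanishing
  \<open>g\<close>: pseudo-division leaves a remainder of smaller degree that vanishes too, hence is
  0, and the integer factor it introduces is removed by Gauss's lemma.\<close>

lemma minimal_int_poly_exists:
  fixes w :: complex
  assumes P: "lead_coeff P = 1" "eval_int_poly P w = 0"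
  shows "\<exists>f. lead_coeff f = 1 \<and> (\<forall>g. eval_int_poly g w = 0 \<longleftrightarrow> f dvd g)"
proof -
  define Q where "Q = (\<lambda>f :: int poly. f \<noteq> 0 \<and> eval_int_poly f w = 0)"
  have "Q P" using P by (auto simp: Q_def)
  define f0 where "f0 = arg_min degree Q"
  have f0: "Q f0" and min: "\<And>g. Q g \<Longrightarrow> degree f0 \<le> degree g"
    unfolding f0_def using arg_min_nat_lemma[of Q P degree] \<open>Q P\<close> by auto
  define f where "f = primitive_part f0"
  have nz: "f0 \<noteq> 0" using f0 by (simp add: Q_def)
  have cf: "content f = 1" using nz by (simp add: f_def)
  have fnz: "f \<noteq> 0" using cf by auto
  have dfl: "degree f = degree f0" by (simp add: f_def)
  have "eval_int_poly (smult (content f0) f) w = 0"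
    using f0 by (simp add: f_def Q_def del: eval_int_poly_smult)
  then have fw: "eval_int_poly f w = 0" using nz by simp
  have dvd: "f dvd g" if g: "eval_int_poly g w = 0" for g
  proof -
    define r where "r = pseudo_mod g f"
    from pseudo_mod[OF fnz, of g] obtain a q where
      aq: "a \<noteq> 0" "smult a g = f * q + r" and r: "r = 0 \<or> degree r < degree f"
      by (auto simp: r_def)
    have rw: "eval_int_poly r w = 0"
      using arg_cong[OF aq(2), of "\<lambda>p. eval_int_poly p w"] g fw by simp
    have "r = 0"
    proof (rule ccontr)
      assume "r \<noteq> 0"
      then have "degree f \<le> degree r" using min[of r] dfl rw by (simp add: Q_def)
      then show False using r \<open>r \<noteq> 0\<close> by simp
    qed
    show ?thesis using aq(2) \<open>r = 0\<close> primitive_dvd_smultD[OF cf aq(1), of g] by simp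
  qed
  have iff: "eval_int_poly g w = 0 \<longleftrightarrow> f dvd g" for g
    using dvd fw by auto
  have "f dvd P" using iff P by simp
  then obtain h where "P = f * h" by auto
  \<comment> \<open>The leading coefficient of \<open>f\<close> divides that of the monic
    \<open>P\<close>, so it is a unit; only the sign remains to be corrected.\<close>
  then have "lead_coeff f * lead_coeff h = 1" using P by (simp add: lead_coeff_mult)
  then have lc: "\<bar>lead_coeff f\<bar> = 1"
    by (metis zmult_eq_1_iff abs_1 abs_minus_cancel)
  show ?thesis
  proof (rule exI[of _ "smult (lead_coeff f) f"], intro conjI allI)
    show "lead_coeff (smult (lead_coeff f) f) = 1"
      using lc fnz by (simp add: abs_if split: if_splits)
    show "eval_int_poly g w = 0 \<longleftrightarrow> smult (lead_coeff f) f dvd g" for g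
      using lc iff[of g] by (auto simp: abs_if smult_dvd_iff split: if_splits)
  qed
qed

section \<open>Frobenius congruences modulo a prime\<close>

lemma prime_dvd_add_power_diff:
  fixes x y :: "'a :: comm_ring_1"
  assumes p: "prime p"
  shows "of_nat p dvd (x + y) ^ p - (x ^ p + y ^ p)"
proof -
  have "(x + y) ^ p = (\<Sum>k\<le>p. of_nat (p choose k) * x ^ k * y ^ (p - k))"
    by (rule binomial_ring)
  also have "{..p} = insert 0 (insert p {1..<p})" using prime_gt_0_nat[OF p] by auto
  also have "(\<Sum>k\<in>\<dots>. of_nat (p choose k) * x ^ k * y ^ (p - k))
    = y ^ p + (x ^ p + (\<Sum>k\<in>{1..<p}. of_nat (p choose k) * x ^ k * y ^ (p - k)))"
    using prime_gt_0_nat[OF p] by simp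
  finally have "(x + y) ^ p - (x ^ p + y ^ p)
     = (\<Sum>k\<in>{1..<p}. of_nat (p choose k) * x ^ k * y ^ (p - k))" by simp
  moreover have "of_nat p dvd of_nat (p choose k) * x ^ k * y ^ (p - k)" if "k \<in> {1..<p}" for k
  proof -
    have "p dvd p choose k" using that p by (intro dvd_choose_prime) auto
    then obtain c where "p choose k = p * c" by auto
    then show ?thesis by (simp add: mult.assoc)
  qed
  ultimately show ?thesis by (auto intro: dvd_sum)
qed

text \<open>Fermat's little theorem; the binomial congruence with second summand 1 is the induction
  step in both directions.\<close>

lemma prime_dvd_power_diff_int:
  assumes p: "prime p"
  shows "int p dvd a ^ p - a"
proof (induction a rule: int_induct[where k = 0])
  case base
  then show ?case using p by (simp add: power_0_left prime_gt_0_nat)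
next
  case (step1 i)
  have "int p dvd ((i + 1) ^ p - (i ^ p + 1 ^ p)) + (i ^ p - i)"
    using step1 prime_dvd_add_power_diff[OF p, of i 1] by (intro dvd_add) simp_all
  then show ?case by (simp add: algebra_simps)
next
  case (step2 i)
  have "int p dvd (i ^ p - i) - (((i - 1) + 1) ^ p - ((i - 1) ^ p + 1 ^ p))"
    using prime_dvd_add_power_diff[OF p, of "i - 1" 1] step2.IH
    by (intro dvd_diff[of _ "i ^ p - i"]) (simp_all only: of_nat_id)
  then show ?case by (simp add: algebra_simps)
qed

text \<open>The Frobenius map modulo \<open>p\<close> is additive by the binomial congruence, fixes
  the constants by Fermat, and sends the variable to its \<open>p\<close>-th power.\<close>

lemma prime_dvd_pcompose_monom_diff_power:
  fixes f :: "int poly"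
  assumes p: "prime p"
  shows "[:int p:] dvd pcompose f (monom 1 p) - f ^ p"
proof (induction f)
  case 0
  then show ?case using p by (simp add: power_0_left prime_gt_0_nat)
next
  case (pCons a f)
  let ?P = "[:int p:]"
  have fermat: "?P dvd [:a:] - [:a:] ^ p"
  proof -
    have "[:a:] - [:a:] ^ p = [:a - a ^ p:]"
      by (simp add: poly_const_pow)
    then show ?thesis using prime_dvd_power_diff_int[OF p, of a]
      by (simp add: dvd_diff_commute)
  qed
  define m where "m = pCons 0 f"
  have "?P dvd monom 1 p * (pcompose f (monom 1 p) - f ^ p)" using pCons by simp
  also have "monom 1 p * (pcompose f (monom 1 p) - f ^ p)
      = pcompose (pCons a f) (monom 1 p) - [:a:] - m ^ p"
  proof -
    have "m = monom 1 1 * f" by (simp add: m_def monom_Suc monom_0)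
    then have "m ^ p = monom 1 p * f ^ p" by (simp add: power_mult_distrib monom_power)
    then show ?thesis by (simp add: pcompose_pCons algebra_simps)
  qed
  finally have 1: "?P dvd pcompose (pCons a f) (monom 1 p) - [:a:] - m ^ p" .
  have split: "pCons a f = [:a:] + m" by (simp add: m_def)
  have dream: "?P dvd ([:a:] + m) ^ p - ([:a:] ^ p + m ^ p)"
    using prime_dvd_add_power_diff[OF p, of "[:a:]" m] by (simp only: of_nat_poly of_nat_id)
  \<comment> \<open>Each of the three differences is a multiple of \<open>p\<close>; in the total,
    the separate terms in \<open>[:a:]\<close> and \<open>m\<close> cancel.\<close>
  have "?P dvd (pcompose (pCons a f) (monom 1 p) - [:a:] - m ^ p)
      + ([:a:] - [:a:] ^ p) - (([:a:] + m) ^ p - ([:a:] ^ p + m ^ p))"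
    by (intro dvd_diff dvd_add 1 fermat dream)
  also have "\<dots> = pcompose (pCons a f) (monom 1 p) - (pCons a f) ^ p"
    unfolding split by simp
  finally show ?case .
qed


section \<open>Conjugates of a primitive root of unity\<close>

text \<open>As the complex numbers have no zero divisors, \<open>f\<close> behaves like a prime:
  from \<open>f = h * q\<close> it divides \<open>h\<close> or \<open>q\<close>. The second case
  would leave degree 0 for \<open>h\<close>, and the monic \<open>h\<close> would be 1 and could not
  vanish at \<open>z\<close>.\<close>

lemma minimal_int_poly_conjugate:
  fixes w z :: complex
  assumes lc: "lead_coeff f = 1"
    and min: "\<And>g. eval_int_poly g w = 0 \<longleftrightarrow> f dvd g"
    and z: "eval_int_poly f z = 0"
  shows "eval_int_poly g z = 0 \<longleftrightarrow> f dvd g"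
proof -
  obtain h where h: "lead_coeff h = 1" "\<And>g. eval_int_poly g z = 0 \<longleftrightarrow> h dvd g"
    using minimal_int_poly_exists[OF lc z] by blast
  have "h dvd f" using h(2) z by simp
  then obtain q where q: "f = h * q" by auto
  have fnz: "f \<noteq> 0" using lc by auto
  have "eval_int_poly h w * eval_int_poly q w = 0"
    using min[of f] q by simp
  then have "f dvd h \<or> f dvd q" using min by auto
  moreover have "\<not> f dvd q"
  proof
    assume "f dvd q"
    moreover have nz: "h \<noteq> 0" "q \<noteq> 0" using q fnz by auto
    ultimately have "degree f \<le> degree q" by (intro dvd_imp_degree_le)
    then have "degree h = 0" using q nz by (simp add: degree_mult_eq)
    then have "h = 1" using h(1) by (metis degree_0_id one_pCons lead_coeff_pCons(1) of_int_1 degree_eq_zeroE lead_coeff_pCons(2))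
    then show False using h(2)[of h] by simp
  qed
  ultimately have "f dvd h" by blast
  then show ?thesis using \<open>h dvd f\<close> h(2) dvd_trans by blast
qed

text \<open>Pseudo-division multiplies the dividend by a power of the leading coefficient of the
  divisor, here 1.\<close>

lemma monic_division_exists:
  fixes f g :: "'a :: idom poly"
  assumes "lead_coeff f = 1"
  shows "\<exists>q r. g = f * q + r \<and> (r = 0 \<or> degree r < degree f)"
proof -
  have "f \<noteq> 0" using assms by auto
  then show ?thesis
    using pseudo_divmod[of f g "fst (pseudo_divmod g f)" "snd (pseudo_divmod g f)"] assms
    by (metis power_one prod.collapse smult_1_left)
qed

text \<open>Landau's argument: the finitely many values \<open>f(w^j)\<close> are represented by polynomials of
  degree less than \<open>degree f\<close> with coefficients bounded by some \<open>A\<close>, whereas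
  \<open>f(w^p) = f(w^p) - f(w)^p\<close> is represented by such a polynomial divisible by \<open>p\<close>.\<close>

lemma minimal_int_poly_root_of_unity_prime_power:
  fixes w :: complex
  assumes l: "l > 0" "w ^ l = 1" and lc: "lead_coeff f = 1"
    and min: "\<And>g. eval_int_poly g w = 0 \<longleftrightarrow> f dvd g"
  shows "\<exists>A. \<forall>p z. prime p \<longrightarrow> A < p \<longrightarrow> eval_int_poly f z = 0 \<longrightarrow> eval_int_poly f (z ^ p :: complex) = 0"
proof -
  have fw: "eval_int_poly f w = 0" using min by simp
  have small: "r = 0" if "eval_int_poly r w = 0" "r = 0 \<or> degree r < degree f" for r
  proof (rule ccontr)
    assume "r \<noteq> 0"
    then have "degree f \<le> degree r" using that(1) min by (intro dvd_imp_degree_le) auto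
    then show False using that(2) \<open>r \<noteq> 0\<close> by simp
  qed
  have "\<exists>r. eval_int_poly r w = eval_int_poly g w \<and> (r = 0 \<or> degree r < degree f)" for g
    using monic_division_exists[OF lc, of g] fw by force
  then have "\<forall>j. \<exists>r. eval_int_poly r w = eval_int_poly f (w ^ j) \<and> (r = 0 \<or> degree r < degree f)"
    by (metis eval_int_poly_pcompose eval_int_poly_monom of_int_1 mult_1)
  then obtain r where r: "\<And>j. eval_int_poly (r j) w = eval_int_poly f (w ^ j)"
      "\<And>j. r j = 0 \<or> degree (r j) < degree f"
    by metis
  define S where "S = (\<lambda>(j, i). nat \<bar>coeff (r j) i\<bar>) ` ({..<l} \<times> {..degree f})"
  have "finite S" by (simp add: S_def)
  then obtain A where A: "\<And>s. s \<in> S \<Longrightarrow> s < A"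
    unfolding finite_nat_set_iff_bounded by blast
  have "eval_int_poly f (w ^ p) = 0" if p: "prime p" "A < p" for p
  proof -
    define j where "j = p mod l"
    have wj: "w ^ p = w ^ j"
      unfolding j_def using l(2)
      by (metis div_mult_mod_eq mult.commute mult_1 power_add power_mult power_one)
    obtain g where g: "pcompose f (monom 1 p) - f ^ p = [:int p:] * g"
      using prime_dvd_pcompose_monom_diff_power[OF p(1), of f] by (auto simp: dvd_def)
    obtain q s where s: "g = f * q + s" "s = 0 \<or> degree s < degree f"
      using monic_division_exists[OF lc, of g] by blast
    have "eval_int_poly f (w ^ p) = of_nat p * eval_int_poly s w"
      using arg_cong[OF g, of "\<lambda>h. eval_int_poly h w"] fw s(1) prime_gt_0_nat[OF p(1)]
      by (simp add: power_0_left)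
    then have "eval_int_poly (r j - smult (int p) s) w = 0"
      using r(1)[of j] wj by simp
    moreover have "r j - smult (int p) s = 0 \<or> degree (r j - smult (int p) s) < degree f"
      using r(2)[of j] s(2) by (auto intro!: degree_diff_less)
    ultimately have rj: "r j = smult (int p) s" using small by fastforce
    have "coeff (r j) i = 0" for i
    proof (rule ccontr)
      assume nz: "coeff (r j) i \<noteq> 0"
      then have "i \<le> degree (r j)" by (rule le_degree)
      then have "i \<le> degree f" using r(2)[of j] nz by auto
      moreover have "j < l" using l by (simp add: j_def)
      ultimately have "nat \<bar>coeff (r j) i\<bar> \<in> S" by (force simp: S_def)
      then have "nat \<bar>coeff (r j) i\<bar> < p" using A p(2) by force
      moreover have "int p dvd coeff (r j) i" using rj by simp
      then have "int p \<le> \<bar>coeff (r j) i\<bar>" using nz by (metis dvd_imp_le_int abs_of_nat)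
      ultimately show False by simp
    qed
    then have "r j = 0" by (simp add: poly_eq_iff)
    then show ?thesis using r(1)[of j] wj by simp
  qed
  \<comment> \<open>Vanishing at \<open>w ^ p\<close> alone could not be iterated. Restated as a
    divisibility of polynomials, it passes to every root \<open>z\<close> of \<open>f\<close>, with
    the same bound \<open>A\<close>.\<close>
  then have "f dvd pcompose f (monom 1 p)" if "prime p" "A < p" for p
    using that min[of "pcompose f (monom 1 p)"] by simp
  moreover have "eval_int_poly f (z ^ p) = 0"
    if "f dvd pcompose f (monom 1 p)" "eval_int_poly f z = 0" for p and z :: complex
  proof -
    from that(1) obtain h where h: "pcompose f (monom 1 p) = f * h" by auto
    show ?thesis using arg_cong[OF h, of "\<lambda>h. eval_int_poly h z"] that(2) by simp
  qed
  ultimately show ?thesis by blast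
qed

text \<open>To \<open>m\<close> is added \<open>l\<close> times the product of the primes up to
  \<open>A\<close> that do not divide \<open>m\<close>. A prime up to \<open>A\<close> then divides
  exactly one of the two summands: if it divides \<open>m\<close>, it divides neither
  \<open>l\<close>, by coprimality, nor the product; otherwise it is a factor of the
  product.\<close>

lemma coprime_shift_large_prime_factors:
  fixes m l A :: nat
  assumes "coprime m l" "l > 0"
  shows "\<exists>n>0. [n = m] (mod l) \<and> (\<forall>q. prime q \<longrightarrow> q dvd n \<longrightarrow> A < q)"
proof -
  define P where "P = {q. prime q \<and> q \<le> A \<and> \<not> q dvd m}"
  have fin: "finite P" by (rule finite_subset[of _ "{..A}"]) (auto simp: P_def)
  define n where "n = m + l * \<Prod>P"
  have "\<Prod>P > 0" by (rule prod_pos) (auto simp: P_def prime_gt_0_nat)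
  then have "n > 0" using assms by (simp add: n_def)
  moreover have "[n = m] (mod l)" by (simp add: n_def cong_def)
  moreover have "A < q" if q: "prime q" "q dvd n" for q
  proof (rule ccontr)
    assume "\<not> A < q"
    show False
    proof (cases "q dvd m")
      case True
      then have "q dvd l * \<Prod>P" using q(2) by (simp add: n_def dvd_add_right_iff)
      moreover have "\<not> q dvd l"
        using True assms(1) q(1) by (meson coprime_common_divisor not_prime_unit)
      ultimately have "q dvd \<Prod>P" using q(1) by (simp add: prime_dvd_mult_iff)
      then obtain p where "p \<in> P" "q dvd p" using prime_dvd_prod_iff[OF fin, of q "\<lambda>x. x"] q(1) by auto
      then show False using q(1) True primes_dvd_imp_eq[of q p] by (auto simp: P_def)
    next
      case False
      then have "q \<in> P" using \<open>\<not> A < q\<close> q(1) by (auto simp: P_def)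
      then have "q dvd \<Prod>P" using fin by (intro dvd_prodI)
      then show False using False q(2) by (simp add: n_def dvd_add_left_iff)
    qed
  qed
  ultimately show ?thesis by blast
qed

text \<open>Avoids primes in arithmetic progressions: \<open>w ^ m\<close> depends only on
  \<open>m\<close> modulo \<open>l\<close>, so \<open>m\<close> is replaced by a number whose prime
  factors all exceed \<open>A\<close>. These are applied one at a time, which is why the root varies
  in the induction.\<close>

lemma minimal_int_poly_root_of_unity_coprime_power:
  fixes w :: complex
  assumes l: "l > 0" "w ^ l = 1" and lc: "lead_coeff f = 1"
    and min: "\<And>g. eval_int_poly g w = 0 \<longleftrightarrow> f dvd g"
    and m: "coprime m l"
  shows "eval_int_poly f (w ^ m) = 0"
proof -
  obtain A where A: "\<And>p z. prime p \<Longrightarrow> A < p \<Longrightarrow> eval_int_poly f z = 0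
      \<Longrightarrow> eval_int_poly f (z ^ p :: complex) = 0"
    using minimal_int_poly_root_of_unity_prime_power[OF l lc min] by blast
  obtain n where n: "n > 0" "[n = m] (mod l)" "\<forall>q. prime q \<longrightarrow> q dvd n \<longrightarrow> A < q"
    using coprime_shift_large_prime_factors[OF m l(1), of A] by blast
  have "n > 0 \<Longrightarrow> \<forall>q. prime q \<longrightarrow> q dvd n \<longrightarrow> A < q \<Longrightarrow> eval_int_poly f z = 0 \<Longrightarrow> eval_int_poly f (z ^ n) = 0"
    for z :: complex
  proof (induction n arbitrary: z rule: prime_divisors_induct)
    case (factor p n)
    have "eval_int_poly f ((z ^ p) ^ n) = 0"
    proof (rule factor.IH)
      show "eval_int_poly f (z ^ p) = 0"
        by (rule A) (use factor.prems factor.hyps in auto)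
    qed (use factor.prems in auto)
    then show ?case by (simp add: power_mult)
  qed auto
  then have "eval_int_poly f (w ^ n) = 0" using n min[of f] by simp
  moreover have "w ^ n = w ^ m"
    using n(2) l(2) unfolding cong_def
    by (metis div_mult_mod_eq mult.commute mult_1 power_add power_mult power_one)
  ultimately show ?thesis by simp
qed

text \<open>The witness is \<open>l\<close> divided by the gcd. In terms of roots of unity: the
  \<open>k\<close>-th power of an \<open>l\<close>-th root of unity has order less than
  \<open>l\<close> when \<open>k\<close> is not prime to \<open>l\<close>.\<close>

lemma not_coprime_dvd_mult:
  fixes k l :: nat
  assumes "l > 0" "\<not> coprime k l"
  shows "\<exists>e. 0 < e \<and> e < l \<and> l dvd k * e"
proof -
  define d where "d = gcd k l"
  have "d \<noteq> 1" using assms(2) by (simp add: d_def coprime_iff_gcd_eq_1)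
  moreover have "d > 0" using assms(1) by (simp add: d_def)
  ultimately have d: "d > 1" by linarith
  obtain e where e: "l = d * e" unfolding d_def by (meson dvdE gcd_dvd2)
  obtain j where j: "k = d * j" unfolding d_def by (meson dvdE gcd_dvd1)
  have "k * e = l * j" using e j by simp
  then show ?thesis using d e assms(1) by (intro exI[of _ e]) auto
qed

text \<open>The minimal polynomial \<open>f\<close> of \<open>w\<close> is the integer polynomial
  presupposed by \<open>cyclo\<close>: its complex roots are exactly the primitive
  \<open>l\<close>-th roots of unity, all of them simple, so over the complex numbers it is the
  defining product.\<close>

theorem cyclo_minimal:
  fixes w :: complex
  assumes l: "l > 0" and w: "w ^ l = 1" "\<forall>m. 0 < m \<and> m < l \<longrightarrow> w ^ m \<noteq> 1"
  shows "eval_int_poly g w = 0 \<longleftrightarrow> cyclo l dvd g"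
proof -
  have "lead_coeff (monom 1 l - 1 :: int poly) = 1"
    using lead_coeff_add_le[of "- 1" "monom 1 l :: int poly"] l by (simp add: degree_monom_eq)
  moreover have "eval_int_poly (monom 1 l - 1) w = 0" using w by simp
  ultimately obtain f where lc: "lead_coeff f = 1"
    and min: "\<And>g. eval_int_poly g w = 0 \<longleftrightarrow> f dvd g"
    using minimal_int_poly_exists by blast
  have "f dvd monom 1 l - 1" using w by (simp flip: min)
  then obtain h where h: "monom 1 l - 1 = f * h" by auto
  define c where "c = (\<lambda>k::nat. cis (2 * pi * real k / real l))"
  have c_pow: "c k = c 1 ^ k" for k
    by (simp add: c_def DeMoivre mult_ac)
  have c_bij: "bij_betw c {..<l} {z. z ^ l = 1}"
    unfolding c_def by (rule bij_betw_roots_unity) (rule l)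
  have c1: "c k ^ l = 1" for k
  proof -
    have "c 1 ^ l = 1"
      using l by (simp add: c_def DeMoivre)
    then show ?thesis by (metis c_pow power_mult mult.commute power_one)
  qed
  have c_mod: "c k = c (k mod l)" for k
    using c1[of 1] c_pow[of k] c_pow[of "k mod l"]
    by (metis div_mult_mod_eq mult.commute mult_1 power_add power_mult power_one)
  have root_pow: "z ^ l = 1" if "eval_int_poly f z = 0" for z :: complex
    using arg_cong[OF h, of "\<lambda>p. eval_int_poly p z"] that by simp
  obtain j where j: "w = c j"
    using w(1) c_bij unfolding bij_betw_def by blast
  have "coprime j l"
  proof (rule ccontr)
    assume "\<not> coprime j l"
    then obtain e i where e: "0 < e" "e < l" "j * e = l * i"
      using not_coprime_dvd_mult[OF l] unfolding dvd_def by blast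
    have "w ^ e = (c 1 ^ l) ^ i"
      unfolding j c_pow[of j] power_mult[symmetric] e(3) ..
    then show False using w(2) e c1 by simp
  qed
  have root_iff: "eval_int_poly f (c k) = 0 \<longleftrightarrow> coprime k l" for k
  proof
    assume "coprime k l"
    \<comment> \<open>With \<open>i\<close> inverse to \<open>j\<close>, the root \<open>c k\<close>
      becomes \<open>w ^ (i * k)\<close>, a power of \<open>w\<close> with exponent prime to
      \<open>l\<close>.\<close>
    obtain i where "[j * i = 1] (mod l)"
      using \<open>coprime j l\<close> cong_solve_coprime_nat by auto
    then have ji: "[j * (i * k) = k] (mod l)"
      by (metis cong_scalar_right mult.assoc mult_1)
    then have "coprime (j * (i * k)) l" using \<open>coprime k l\<close>
      by (metis cong_imp_coprime cong_sym)
    then have "coprime (i * k) l" by simp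
    have "c k = w ^ (i * k)"
    proof -
      have "w ^ (i * k) = c (j * (i * k))" unfolding j c_pow[of j] c_pow[of "j * _"]
        by (simp add: power_mult)
      also have "\<dots> = c k" using ji c_mod by (metis cong_def)
      finally show ?thesis by simp
    qed
    then show "eval_int_poly f (c k) = 0"
      using minimal_int_poly_root_of_unity_coprime_power[OF l w(1) lc min \<open>coprime (i * k) l\<close>] by simp
  next
    assume f0: "eval_int_poly f (c k) = 0"
    show "coprime k l"
    proof (rule ccontr)
      assume "\<not> coprime k l"
      then obtain e i where e: "0 < e" "e < l" "k * e = l * i"
        using not_coprime_dvd_mult[OF l] unfolding dvd_def by blast
      have "c k ^ e = (c 1 ^ l) ^ i"
        unfolding c_pow[of k] power_mult[symmetric] e(3) ..
      \<comment> \<open>Conjugate roots have the same minimal polynomial, so an order below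
        \<open>l\<close> for \<open>c k\<close> would carry over to \<open>w\<close>.\<close>
      then have "eval_int_poly (monom 1 e - 1) (c k) = 0" using c1 by simp
      then have "f dvd monom 1 e - 1"
        using minimal_int_poly_conjugate[OF lc min f0] by blast
      then have "eval_int_poly (monom 1 e - 1) w = 0" using min by blast
      then show False using w(2) e by simp
    qed
  qed
  define F :: "complex poly" where "F = map_poly of_int f"
  have F: "poly F z = eval_int_poly f z" for z by (simp add: F_def poly_map_poly_of_int)
  have lcF: "lead_coeff F = 1" using lc by (simp add: F_def degree_map_poly coeff_map_poly)
  have "rsquarefree F"
    unfolding rsquarefree_roots
  proof (intro allI notI, elim conjE)
    fix a assume a: "poly F a = 0" "poly (pderiv F) a = 0"
    have "pderiv F = map_poly of_int (pderiv f)"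
      by (rule poly_eqI) (simp add: F_def coeff_pderiv coeff_map_poly)
    then have "eval_int_poly (pderiv f) a = 0" using a(2) by (simp add: poly_map_poly_of_int)
    \<comment> \<open>At a double root of \<open>f\<close> this derivative vanishes, so the root
      would be 0, which is no root of unity.\<close>
    moreover have "pderiv (monom 1 l - 1) = f * pderiv h + h * pderiv f"
      by (simp add: h pderiv_mult)
    ultimately have "eval_int_poly (pderiv (monom 1 l - 1)) a = 0"
      using a(1) F by simp
    then have "of_nat l * a ^ (l - 1) = 0" by (simp add: pderiv_diff pderiv_monom)
    then have "a = 0" using l by simp
    then show False using root_pow[of a] a(1) F l by (simp add: power_0_left)
  qed
  then have "F = (\<Prod>z | poly F z = 0. [:- z, 1:])"
    using complex_poly_decompose_rsquarefree[of F] lcF by simp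
  also have "\<dots> = (\<Prod>k\<in>{k\<in>{1..l}. coprime k l}. [:- c k, 1:])"
  proof (rule prod.reindex_bij_betw[symmetric])
    \<comment> \<open>\<open>cyclo\<close> indexes the roots from 1 to \<open>l\<close>, whereas
      \<open>c_bij\<close> runs from 0 to \<open>l - 1\<close>; the indices 0 and \<open>l\<close>
      give the same root.\<close>
    have c_l: "c l = c 0" using c_mod[of l] by simp
    have inj: "inj_on c {1..l}"
    proof (rule inj_onI)
      fix x y assume xy: "x \<in> {1..l}" "y \<in> {1..l}" "c x = c y"
      then have "c (x mod l) = c (y mod l)" using c_mod by metis
      then have "x mod l = y mod l" using c_bij l by (auto simp: bij_betw_def inj_on_def)
      then show "x = y" using xy(1,2) by (cases "x = l"; cases "y = l") auto
    qed
    show "bij_betw c {k\<in>{1..l}. coprime k l} {z. poly F z = 0}"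
      unfolding bij_betw_def
    proof (intro conjI)
      show "inj_on c {k\<in>{1..l}. coprime k l}" using inj by (rule inj_on_subset) auto
      have surj: "\<exists>k\<in>{1..l}. z = c k" if "poly F z = 0" for z
      proof -
        have "z ^ l = 1" using that F root_pow by simp
        then obtain k where "k < l" "z = c k" using c_bij unfolding bij_betw_def by blast
        then show ?thesis using c_l l
          by (intro bexI[of _ "if k = 0 then l else k"]) auto
      qed
      show "c ` {k\<in>{1..l}. coprime k l} = {z. poly F z = 0}"
      proof (intro equalityI subsetI)
        fix z assume "z \<in> {z. poly F z = 0}"
        then show "z \<in> c ` {k\<in>{1..l}. coprime k l}" using surj[of z] root_iff F by auto
      next
        fix z assume "z \<in> c ` {k\<in>{1..l}. coprime k l}"
        then show "z \<in> {z. poly F z = 0}" using root_iff F by auto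
      qed
    qed
  qed
  finally have "F = (\<Prod>k\<in>{k\<in>{1..l}. coprime k l}. [:- cis (2 * pi * real k / real l), 1:])"
    unfolding c_def .
  moreover have "p = f" if "map_poly of_int p = F" for p
  proof (rule poly_eqI)
    fix n
    have "coeff (map_poly of_int p) n = coeff (F :: complex poly) n" using that by simp
    then show "coeff p n = coeff f n" by (simp add: F_def coeff_map_poly)
  qed
  ultimately have "cyclo l = f"
    unfolding cyclo_def F_def by (intro the_equality) metis+
  then show ?thesis by (simp only: min)
qed

section \<open>Toric frames and their mutations\<close>

lemma bil_add_left: "bil L (\<lambda>i. f i + f' i) g = bil L f g + bil L f' g"
  by (simp add: bil_def algebra_simps sum.distrib)

lemma bil_add_right: "bil L f (\<lambda>i. g i + g' i) = bil L f g + bil L f g'"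
  by (simp add: bil_def algebra_simps sum.distrib)

lemma bil_scale_left: "bil L (\<lambda>i. c * f i) g = c * bil L f g"
  by (simp add: bil_def sum_distrib_left mult_ac)

lemma bil_scale_right: "bil L f (\<lambda>i. c * g i) = c * bil L f g"
  by (simp add: bil_def sum_distrib_left mult_ac)

lemma bil_minus_left: "bil L (\<lambda>i. - f i) g = - bil L f g"
  using bil_scale_left[of L "-1"] by simp

lemma bil_minus_right: "bil L f (\<lambda>i. - g i) = - bil L f g"
  using bil_scale_right[of L f "-1"] by simp

lemma bil_zero_left [simp]: "bil L (\<lambda>i. 0) g = 0"
  by (simp add: bil_def)

lemma bil_zero_right [simp]: "bil L f (\<lambda>i. 0) = 0"
  by (simp add: bil_def)

lemma bil_swap:
  assumes "\<forall>i j. L i j = - L j i"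
  shows "bil L g f = - bil L f g"
proof -
  have "bil L g f = (\<Sum>j\<in>UNIV. \<Sum>i\<in>UNIV. g i * L i j * f j)"
    unfolding bil_def by (rule sum.swap)
  also have "\<dots> = (\<Sum>j\<in>UNIV. \<Sum>i\<in>UNIV. - (f j * L j i * g i))"
  proof (intro sum.cong refl)
    fix i j show "g i * L i j * f j = - (f j * L j i * g i)"
      using spec[OF spec[OF assms, of i], of j] by simp
  qed
  also have "\<dots> = - bil L f g" by (simp add: bil_def sum_negf)
  finally show ?thesis .
qed

lemma bil_self:
  assumes "\<forall>i j. L i j = - L j i"
  shows "bil L f f = 0"
  using bil_swap[OF assms, of f f] by simp

lemma bil_sum_left: "bil L (\<lambda>p. \<Sum>i\<in>A. c i p) g = (\<Sum>i\<in>A. bil L (c i) g)"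
  by (induction A rule: infinite_finite_induct) (simp_all add: bil_add_left)

lemma bil_sum_right: "bil L f (\<lambda>p. \<Sum>i\<in>A. c i p) = (\<Sum>i\<in>A. bil L f (c i))"
  by (induction A rule: infinite_finite_induct) (simp_all add: bil_add_right)

lemma bil_unitv_right: "bil L f (unitv i) = (\<Sum>p\<in>UNIV. f p * L p i)"
  by (simp add: bil_def unitv_def if_distrib cong: if_cong)

lemma bil_unitv: "bil L (unitv i) (unitv j) = L i j"
proof -
  have "unitv i p * L p j = (if p = i then L p j else 0)" for p
    by (simp add: unitv_def)
  then show ?thesis by (simp add: bil_unitv_right)
qed

text \<open>The linear map with matrix \<open>mut_E B k\<close>. The mutated form is the pull-back
  of the old one along it, which keeps the double sums of \<open>mut_L\<close> out of later
  arguments.\<close>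

definition mut_vec :: "('n::finite \<Rightarrow> 'n \<Rightarrow> int) \<Rightarrow> 'n \<Rightarrow> ('n \<Rightarrow> int) \<Rightarrow> 'n \<Rightarrow> int" where
  "mut_vec B k f = (\<lambda>p. \<Sum>i\<in>UNIV. f i * mut_E B k p i)"

lemma mut_vec_eq:
  "mut_vec B k f = (\<lambda>p. if p = k then - f k else f p + f k * max 0 (- B p k))"
proof
  fix p
  have "mut_vec B k f p
      = f k * mut_E B k p k + (\<Sum>i\<in>UNIV - {k}. f i * mut_E B k p i)"
    unfolding mut_vec_def by (simp add: sum.remove[of UNIV k])
  also have "(\<Sum>i\<in>UNIV - {k}. f i * mut_E B k p i) = (\<Sum>i\<in>UNIV - {k}. if i = p then f p else 0)"
    by (rule sum.cong) (auto simp: mut_E_def)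
  also have "f k * mut_E B k p k + \<dots> = (if p = k then - f k else f p + f k * max 0 (- B p k))"
    by (simp add: sum.delta' mut_E_def)
  finally show "mut_vec B k f p = (if p = k then - f k else f p + f k * max 0 (- B p k))" .
qed

lemma bil_mut_L: "bil (mut_L L B k) f g = bil L (mut_vec B k f) (mut_vec B k g)"
proof -
  have L: "mut_L L B k i j = bil L (\<lambda>a. mut_E B k a i) (\<lambda>b. mut_E B k b j)" for i j
    by (simp add: mut_L_def bil_def)
  show ?thesis
    unfolding mut_vec_def bil_sum_left bil_sum_right bil_scale_left bil_scale_right
    unfolding bil_def[of "mut_L L B k"] L by (simp add: mult_ac)
qed

lemma mut_L_skew:
  assumes "\<forall>i j. L i j = - L j i"
  shows "\<forall>i j. mut_L L B k i j = - mut_L L B k j i"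
  using bil_swap[OF assms] by (metis bil_mut_L bil_unitv)

text \<open>Induction on the sum of the absolute values. \<open>J\<close> holds the coordinates that
  may become negative: \<open>UNIV\<close> for a whole frame, \<open>ex \<union> invs\<close> for
  the mixed torus, \<open>{}\<close> for monomials without inverses.\<close>

lemma int_vec_induct [case_names nonneg zero plus minus]:
  fixes f :: "'n::finite \<Rightarrow> int"
  assumes "\<And>i. i \<notin> J \<Longrightarrow> f i \<ge> 0"
    and zero: "P (\<lambda>_. 0)"
    and plus: "\<And>f j. (\<And>i. i \<notin> J \<Longrightarrow> f i \<ge> 0) \<Longrightarrow> P f \<Longrightarrow> P (\<lambda>i. f i + unitv j i)"
    and minus: "\<And>f j. j \<in> J \<Longrightarrow> (\<And>i. i \<notin> J \<Longrightarrow> f i \<ge> 0) \<Longrightarrow> P f \<Longrightarrow> P (\<lambda>i. f i + - unitv j i)"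
  shows "P f"
  using assms(1)
proof (induction "\<Sum>i\<in>UNIV. nat \<bar>f i\<bar>" arbitrary: f rule: less_induct)
  case less
  show ?case
  proof (cases "\<exists>j. f j \<noteq> 0")
    case False
    then have "f = (\<lambda>_. 0)" by auto
    then show ?thesis using zero by simp
  next
    case True
    then obtain j where j: "f j \<noteq> 0" by blast
    have smaller: "(\<Sum>i\<in>UNIV. nat \<bar>g i\<bar>) < (\<Sum>i\<in>UNIV. nat \<bar>f i\<bar>)"
      if "nat \<bar>g j\<bar> < nat \<bar>f j\<bar>" "\<And>i. i \<noteq> j \<Longrightarrow> g i = f i" for g
    proof (rule sum_strict_mono_ex1)
      show "\<forall>i\<in>UNIV. nat \<bar>g i\<bar> \<le> nat \<bar>f i\<bar>"
        using that by (metis order.refl order.strict_implies_order)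
    qed (use that in auto)
    show ?thesis
    proof (cases "f j > 0")
      case True
      define g where "g = (\<lambda>i. f i - unitv j i)"
      have "P g"
      proof (rule less.hyps)
        show "g i \<ge> 0" if "i \<notin> J" for i
          using less.prems[OF that] True by (auto simp: g_def unitv_def)
      qed (rule smaller, use True in \<open>auto simp: g_def unitv_def\<close>)
      moreover have "g i \<ge> 0" if "i \<notin> J" for i
        using less.prems[OF that] True by (auto simp: g_def unitv_def)
      ultimately have "P (\<lambda>i. g i + unitv j i)" by (intro plus)
      then show ?thesis by (simp add: g_def)
    next
      case False
      then have neg: "f j < 0" using j by simp
      then have jJ: "j \<in> J" using less.prems[of j] by fastforce
      define g where "g = (\<lambda>i. f i + unitv j i)"
      have g: "g i \<ge> 0" if "i \<notin> J" for i
        using less.prems[OF that] by (auto simp: g_def unitv_def)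
      have "P g"
        by (rule less.hyps[OF smaller g]) (use neg in \<open>auto simp: g_def unitv_def\<close>)
      then have "P (\<lambda>i. g i + - unitv j i)" using g jJ by (intro minus)
      then show ?thesis by (simp add: g_def)
    qed
  qed
qed

text \<open>Compatibility in terms of the form: vectors with zero \<open>j\<close>-th coordinate are
  orthogonal to column \<open>j\<close>. This makes both monomials of an exchange relation commute
  with the remaining variables up to the same scalar.\<close>

lemma compat_bil_column:
  assumes "compat L B D ex" "j \<in> ex"
  shows "bil L (\<lambda>i. B i j) g = D j * g j"
proof -
  have "bil L (\<lambda>i. B i j) g = (\<Sum>q\<in>UNIV. (\<Sum>p\<in>UNIV. B p j * L p q) * g q)"
    unfolding bil_def sum_distrib_right by (rule sum.swap)
  also have "\<dots> = (\<Sum>q\<in>UNIV. (if q = j then D j else 0) * g q)"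
    using assms by (simp add: compat_def)
  also have "\<dots> = (\<Sum>q\<in>UNIV. if q = j then D j * g q else 0)"
    by (rule sum.cong) auto
  also have "\<dots> = D j * g j" by simp
  finally show ?thesis .
qed

lemma compat_diag_zero:
  assumes "compat L B D ex" "k \<in> ex"
  shows "B k k = 0"
proof -
  have "D k > 0" "D k * B k k = - (D k * B k k)" using assms unfolding compat_def by blast+
  then show ?thesis by simp
qed

text \<open>Substitute \<open>\<bar>a\<bar> = a + 2 * max 0 (- a)\<close> and
  \<open>\<bar>b\<bar> = 2 * max 0 b - b\<close>: the terms \<open>a * b\<close> cancel and the
  division by 2 is exact.\<close>

lemma mut_B_eq:
  assumes "i \<noteq> k" "j \<noteq> k"
  shows "mut_B B k i j = B i j + (B i k * max 0 (B k j) + max 0 (- B i k) * B k j)"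
proof -
  have "\<bar>B i k\<bar> * B k j + B i k * \<bar>B k j\<bar> = 2 * (B i k * max 0 (B k j) + max 0 (- B i k) * B k j)"
    by (auto simp: abs_if max_def)
  then show ?thesis using assms by (simp add: mut_B_def)
qed

text \<open>With \<open>E\<close> as in the definition of the mutated frame, \<open>E\<close> maps the \<open>j\<close>-th column of the mutated
  exchange matrix to \<open>b\<^sup>j + [b\<^sub>k\<^sub>j]\<^sub>+ b\<^sup>k\<close> for \<open>j \<noteq> k\<close> and to \<open>- b\<^sup>k\<close> for \<open>j = k\<close>.\<close>

lemma mut_vec_mut_B:
  assumes "B k k = 0"
  shows "mut_vec B k (\<lambda>i. mut_B B k i j)
    = (if j = k then (\<lambda>i. - B i k) else (\<lambda>i. B i j + max 0 (B k j) * B i k))"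
proof (rule ext)
  fix i
  show "mut_vec B k (\<lambda>i. mut_B B k i j) i
    = (if j = k then (\<lambda>i. - B i k) else (\<lambda>i. B i j + max 0 (B k j) * B i k)) i"
    using assms mut_B_eq[of i k j B]
    by (auto simp: mut_vec_eq) (auto simp: mut_B_def algebra_simps)
qed

lemma mult_max_zero: "(d::int) > 0 \<Longrightarrow> d * max 0 x = max 0 (d * x)"
  by (auto simp: max_def mult_le_0_iff zero_le_mult_iff)

text \<open>The mutated form is a pull-back, and the mutated columns are sent to combinations of the
  old columns, whose pairings are known from \<open>compat_bil_column\<close>.\<close>

lemma compat_mut:
  assumes c: "compat L B D ex" and k: "k \<in> ex"
  shows "compat (mut_L L B k) (mut_B B k) D ex"
proof -
  have Bkk: "B k k = 0" by (rule compat_diag_zero[OF c k])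
  have D: "D j > 0" if "j \<in> ex" for j using c that unfolding compat_def by blast
  have DB: "D i * B i j = - (D j * B j i)" if "i \<in> ex" "j \<in> ex" for i j
    using c that unfolding compat_def by blast
  have Dmax: "D j * max 0 (- B j k) = D k * max 0 (B k j)" if "j \<in> ex" for j
    using DB[OF that k] D[OF that] D[OF k] by (simp add: mult_max_zero)
  have "D i * mut_B B k i j = - (D j * mut_B B k j i)" if ij: "i \<in> ex" "j \<in> ex" for i j
  proof (cases "i = k \<or> j = k")
    case True
    then show ?thesis using DB[OF ij] by (auto simp: mut_B_def)
  next
    case False
    \<comment> \<open>Multiplied by \<open>D i\<close>, the correction term of the entry becomes
      antisymmetric in \<open>i\<close> and \<open>j\<close>.\<close>
    have half: "D i * (B i k * max 0 (B k j) + max 0 (- B i k) * B k j)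
       = D k * (max 0 (B k i) * B k j - B k i * max 0 (B k j))" if "i \<in> ex" for i j
    proof -
      have "D i * (B i k * max 0 (B k j) + max 0 (- B i k) * B k j)
         = (D i * B i k) * max 0 (B k j) + (D i * max 0 (- B i k)) * B k j"
        by (simp add: algebra_simps)
      then show ?thesis unfolding DB[OF that k] Dmax[OF that] by (simp add: algebra_simps)
    qed
    show ?thesis
      using False half[OF ij(1), of j] half[OF ij(2), of i] DB[OF ij]
      by (simp add: mut_B_eq distrib_left right_diff_distrib mult.commute)
  qed
  moreover have "(\<Sum>p\<in>UNIV. mut_B B k p j * mut_L L B k p i) = (if i = j then D j else 0)"
    if j: "j \<in> ex" for i j
  proof -
    let ?u = "mut_vec B k (unitv i)"
    have "(\<Sum>p\<in>UNIV. mut_B B k p j * mut_L L B k p i)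
        = bil L (mut_vec B k (\<lambda>p. mut_B B k p j)) ?u"
      using bil_unitv_right[of "mut_L L B k" "\<lambda>p. mut_B B k p j" i] by (simp add: bil_mut_L)
    also have "\<dots> = (if j = k then - (D k * ?u k) else D j * ?u j + max 0 (B k j) * (D k * ?u k))"
      unfolding mut_vec_mut_B[of B k, OF Bkk]
      by (simp add: bil_minus_left bil_add_left bil_scale_left compat_bil_column[OF c] j k)
    also have "\<dots> = (if i = j then D j else 0)"
    \<comment> \<open>For \<open>i = k\<close> and \<open>j \<noteq> k\<close> the two summands
      cancel by \<open>Dmax\<close>.\<close>
    proof (cases "i = k")
      case True
      then show ?thesis using Dmax[OF j]
        by (auto simp: mut_vec_eq unitv_def)
    next
      case False
      then show ?thesis by (auto simp: mut_vec_eq unitv_def)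
    qed
    finally show ?thesis .
  qed
  ultimately show ?thesis using D unfolding compat_def by blast
qed


text \<open>A common setting for both sides: \<open>C\<close> is the image of the scalar ring, and
  \<open>s a\<close> is the image of the \<open>a\<close>-th power of the formal parameter or of the
  root of unity.\<close>

locale central_coeffs =
  fixes C :: "'k::division_ring set" and s :: "int \<Rightarrow> 'k"
  assumes central: "\<And>c x. c \<in> C \<Longrightarrow> c * x = x * c"
    and zero_in: "0 \<in> C"
    and add_in: "\<And>c d. c \<in> C \<Longrightarrow> d \<in> C \<Longrightarrow> c + d \<in> C"
    and mult_in: "\<And>c d. c \<in> C \<Longrightarrow> d \<in> C \<Longrightarrow> c * d \<in> C"
    and s_in: "s a \<in> C"
    and s_0 [simp]: "s 0 = 1"
    and s_add: "s (a + b) = s a * s b"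
begin

lemma one_in: "1 \<in> C"
  using s_in[of 0] by simp

lemma s_comm: "s a * x = x * s a"
  using central s_in by blast

lemma s_comm_left: "x * (s a * y) = s a * (x * y)"
  by (metis s_comm mult.assoc)

lemma s_inverse [simp]: "s a * s (- a) = 1" "s (- a) * s a = 1"
  using s_add[of a "- a"] s_add[of "- a" a] by simp_all

lemma s_cancel: "s a * (s b * x) = s (a + b) * x"
  by (simp add: s_add mult.assoc)

lemma s_nonzero [simp]: "s a \<noteq> 0"
  using s_inverse(1)[of a] by (metis mult_zero_left zero_neq_one)

lemma frame_mult:
  assumes "mult_rel s L M"
  shows "M f * M g = s (bil L f g) * M (\<lambda>i. f i + g i)"
  using assms by (simp add: mult_rel_def)

lemma frame_add:
  assumes "mult_rel s L M"
  shows "M (\<lambda>i. f i + g i) = s (- bil L f g) * (M f * M g)"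
  by (simp add: frame_mult[OF assms] s_cancel)

lemma frame_zero: "mult_rel s L M \<Longrightarrow> M (\<lambda>_. 0) = 1"
  by (simp add: mult_rel_def)

lemma frame_nonzero:
  assumes "mult_rel s L M"
  shows "M f \<noteq> 0"
proof
  assume "M f = 0"
  moreover have "M f * M (\<lambda>i. - f i) = s (bil L f (\<lambda>i. - f i))"
    using frame_mult[OF assms, of f "\<lambda>i. - f i"] frame_zero[OF assms] by simp
  ultimately show False using s_nonzero by (metis mult_zero_left)
qed

lemma frame_inverse:
  assumes "mult_rel s L M"
  shows "M (\<lambda>i. - f i) = s (bil L f (\<lambda>i. - f i)) * inverse (M f)"
proof -
  have "M (\<lambda>i. - f i) * M f = s (bil L f (\<lambda>i. - f i)) * inverse (M f) * M f"
    using frame_mult[OF assms, of "\<lambda>i. - f i" f] frame_zero[OF assms] frame_nonzero[OF assms, of f]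
    by (simp add: mult.assoc bil_minus_left bil_minus_right)
  then show ?thesis using frame_nonzero[OF assms, of f] by simp
qed

lemma frame_comm:
  assumes "mult_rel s L M" "\<forall>i j. L i j = - L j i"
  shows "M f * M g = s (2 * bil L f g) * (M g * M f)"
  unfolding frame_mult[OF assms(1), of f g] frame_mult[OF assms(1), of g f] bil_swap[OF assms(2), of g f]
  by (simp add: s_cancel add.commute)

text \<open>The uniqueness half of the definite description in \<open>mut_M\<close>: up to scalars
  fixed by \<open>L\<close>, every value of a frame is a product of its variables and their
  inverses.\<close>

lemma frame_unique:
  assumes M: "mult_rel s L M" and N: "mult_rel s L N"
    and eq: "\<And>j. M (unitv j) = N (unitv j)"
  shows "M = N"
proof
  fix f
  have "M (\<lambda>i. - unitv j i) = N (\<lambda>i. - unitv j i)" for j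
    by (simp add: frame_inverse[OF M] frame_inverse[OF N] eq)
  then show "M f = N f"
  proof (induction f rule: int_vec_induct[where J = UNIV])
    case (plus f j)
    then show ?case by (simp only: frame_add[OF M] frame_add[OF N] eq)
  next
    case (minus f j)
    then show ?case
      by (simp only: frame_add[OF M, of f "\<lambda>i. - unitv j i"] frame_add[OF N, of f "\<lambda>i. - unitv j i"])
  qed (simp_all add: frame_zero[OF M] frame_zero[OF N])
qed

lemma power_int_skew_commute:
  assumes xy: "x * y = s b * (y * x)" and "x \<noteq> 0"
  shows "x powi m * y = s (m * b) * (y * x powi m)"
proof -
  have nat: "x ^ n * y = s (int n * b) * (y * x ^ n)" for n
  proof (induction n)
    case (Suc n)
    have "x ^ Suc n * y = x * (s (int n * b) * (y * x ^ n))"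
      using Suc by (simp add: mult.assoc)
    also have "\<dots> = s (int n * b) * ((x * y) * x ^ n)"
      by (simp add: s_comm_left mult.assoc)
    also have "\<dots> = s (int (Suc n) * b) * (y * x ^ Suc n)"
      by (simp add: xy mult.assoc s_cancel algebra_simps)
    finally show ?case .
  qed simp
  show ?thesis
  proof (cases m rule: int_cases4)
    case (nonneg n)
    then show ?thesis using nat by simp
  next
    case (neg n)
    let ?z = "x ^ n"
    have z: "?z \<noteq> 0" using \<open>x \<noteq> 0\<close> by simp
    have "y * inverse ?z = inverse ?z * (?z * y) * inverse ?z"
      using z by (simp add: mult.assoc[symmetric])
    also have "\<dots> = s (int n * b) * (inverse ?z * y)"
      unfolding nat using z by (simp add: s_comm_left mult.assoc)
    finally have "s (m * b) * (y * inverse ?z) = inverse ?z * y"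
      using neg by (simp add: s_cancel)
    then show ?thesis using neg by (simp add: power_int_minus)
  qed
qed

text \<open>Has to be carried along every mutation, since it is what keeps the next sum of two
  exchange monomials from vanishing.\<close>

definition indep :: "(('n \<Rightarrow> int) \<Rightarrow> 'k) \<Rightarrow> bool" where
  "indep M \<longleftrightarrow> (\<forall>S c. finite S \<longrightarrow> (\<forall>f\<in>S. c f \<in> C) \<longrightarrow> (\<Sum>f\<in>S. c f * M f) = 0 \<longrightarrow> (\<forall>f\<in>S. c f = 0))"

text \<open>The part of degree \<open>m\<close> of the torus, graded by the \<open>k\<close>-th
  exponent.\<close>

definition homog :: "'n \<Rightarrow> (('n \<Rightarrow> int) \<Rightarrow> 'k) \<Rightarrow> int \<Rightarrow> 'k set" where
  "homog k M m = {y. \<exists>S c. finite S \<and> (\<forall>f\<in>S. f k = m \<and> c f \<in> C) \<and> y = (\<Sum>f\<in>S. c f * M f)}"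

lemma homog_add:
  assumes "x \<in> homog k M m" "y \<in> homog k M m"
  shows "x + y \<in> homog k M m"
proof -
  obtain S c where S: "finite S" "\<forall>f\<in>S. f k = m \<and> c f \<in> C" "x = (\<Sum>f\<in>S. c f * M f)"
    using assms(1) unfolding homog_def by blast
  obtain T d where T: "finite T" "\<forall>f\<in>T. f k = m \<and> d f \<in> C" "y = (\<Sum>f\<in>T. d f * M f)"
    using assms(2) unfolding homog_def by blast
  define e where "e = (\<lambda>f. (if f \<in> S then c f else 0) + (if f \<in> T then d f else 0))"
  have "(\<Sum>f\<in>S \<union> T. e f * M f)
      = (\<Sum>f\<in>S \<union> T. if f \<in> S then c f * M f else 0) + (\<Sum>f\<in>S \<union> T. if f \<in> T then d f * M f else 0)"
    unfolding sum.distrib[symmetric] by (rule sum.cong) (auto simp: e_def distrib_right)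
  also have "\<dots> = x + y"
    unfolding S(3) T(3) using S(1) T(1)
    by (intro arg_cong2[where f = "(+)"]) (auto simp: sum.If_cases Int_absorb1 intro!: sum.cong)
  finally show ?thesis
    using S T zero_in add_in unfolding homog_def
    by (intro CollectI exI[of _ "S \<union> T"] exI[of _ e]) (auto simp: e_def)
qed

lemma homog_sum:
  assumes "\<And>x. x \<in> A \<Longrightarrow> g x \<in> homog k M m"
  shows "(\<Sum>x\<in>A. g x) \<in> homog k M m"
proof -
  have "0 \<in> homog k M m"
    unfolding homog_def by (intro CollectI exI[of _ "{}"]) auto
  then show ?thesis using assms
    by (induction A rule: infinite_finite_induct) (auto intro: homog_add)
qed

lemma homog_gen: "f k = m \<Longrightarrow> c \<in> C \<Longrightarrow> c * M f \<in> homog k M m"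
  unfolding homog_def by (intro CollectI exI[of _ "{f}"] exI[of _ "\<lambda>_. c"]) auto

lemma homog_mult:
  assumes M: "mult_rel s L M" and x: "x \<in> homog k M m" and y: "y \<in> homog k M n"
  shows "x * y \<in> homog k M (m + n)"
proof -
  obtain S c where S: "finite S" "\<forall>f\<in>S. f k = m \<and> c f \<in> C" "x = (\<Sum>f\<in>S. c f * M f)"
    using x unfolding homog_def by blast
  obtain T d where T: "finite T" "\<forall>f\<in>T. f k = n \<and> d f \<in> C" "y = (\<Sum>f\<in>T. d f * M f)"
    using y unfolding homog_def by blast
  have "(c f * M f) * (d g * M g) \<in> homog k M (m + n)" if "f \<in> S" "g \<in> T" for f g
  proof -
    have "(c f * M f) * (d g * M g) = (c f * d g * s (bil L f g)) * M (\<lambda>i. f i + g i)"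
      using frame_mult[OF M, of f g] central[of "d g" "M f"] T(2) that
      by (metis mult.assoc)
    then show ?thesis using S T that by (simp add: homog_gen mult_in s_in)
  qed
  then show ?thesis
    unfolding S(3) T(3) sum_product by (intro homog_sum) auto
qed

lemma homog_power:
  assumes M: "mult_rel s L M" and x: "x \<in> homog k M m"
  shows "x ^ n \<in> homog k M (int n * m)"
proof (induction n)
  case 0
  then show ?case using homog_gen[of "\<lambda>_. 0" k 0 1 M] one_in frame_zero[OF M] by simp
next
  case (Suc n)
  have "x * x ^ n \<in> homog k M (m + int n * m)"
    by (rule homog_mult[OF M x Suc.IH])
  also have "m + int n * m = int (Suc n) * m" by (simp add: algebra_simps)
  finally show ?case by simp
qed

text \<open>Exponents of different degrees are disjoint, so the separate expansions merge into one
  combination; the degree \<open>f k\<close> tells from which expansion the coefficient at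
  \<open>f\<close> is taken.\<close>

lemma homog_independent:
  assumes ind: "indep M" and I: "finite I"
    and Y: "\<And>m. m \<in> I \<Longrightarrow> Y m \<in> homog k M m" and zero: "(\<Sum>m\<in>I. Y m) = 0"
    and m: "m \<in> I"
  shows "Y m = 0"
proof -
  have "\<forall>m\<in>I. \<exists>p. finite (fst p) \<and> (\<forall>f\<in>fst p. f k = m \<and> snd p f \<in> C)
      \<and> Y m = (\<Sum>f\<in>fst p. snd p f * M f)"
    using Y unfolding homog_def by simp
  then obtain p where p: "\<forall>m\<in>I. finite (fst (p m)) \<and> (\<forall>f\<in>fst (p m). f k = m \<and> snd (p m) f \<in> C)
      \<and> Y m = (\<Sum>f\<in>fst (p m). snd (p m) f * M f)"
    by (rule bchoice[THEN exE])
  define S where "S = (\<lambda>m. fst (p m))"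
  define c where "c = (\<lambda>m. snd (p m))"
  have S: "finite (S m)" "f \<in> S m \<Longrightarrow> f k = m \<and> c m f \<in> C" "Y m = (\<Sum>f\<in>S m. c m f * M f)"
    if "m \<in> I" for m f
    using p that unfolding S_def c_def by blast+
  have "(\<Sum>f\<in>(\<Union>m\<in>I. S m). c (f k) f * M f) = (\<Sum>m\<in>I. \<Sum>f\<in>S m. c (f k) f * M f)"
  proof (rule sum.UNION_disjoint[OF I])
    have "i = j" if "i \<in> I" "j \<in> I" "f \<in> S i" "f \<in> S j" for i j f
      using S(2)[OF that(1,3)] S(2)[OF that(2,4)] by simp
    then show "\<forall>i\<in>I. \<forall>j\<in>I. i \<noteq> j \<longrightarrow> S i \<inter> S j = {}" by blast
  qed (use S(1) in blast)
  also have "\<dots> = (\<Sum>m\<in>I. Y m)"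
  proof (rule sum.cong)
    fix m assume m: "m \<in> I"
    show "(\<Sum>f\<in>S m. c (f k) f * M f) = Y m"
      unfolding S(3)[OF m] by (rule sum.cong) (use S(2)[OF m] in auto)
  qed simp
  finally have "(\<Sum>f\<in>(\<Union>m\<in>I. S m). c (f k) f * M f) = 0" using zero by simp
  moreover have "finite (\<Union>m\<in>I. S m)" "\<forall>f\<in>(\<Union>m\<in>I. S m). c (f k) f \<in> C"
    using I S(1,2) by auto
  ultimately have "\<forall>f\<in>(\<Union>m\<in>I. S m). c (f k) f = 0"
    using ind unfolding indep_def by meson
  then have "c m f = 0" if "f \<in> S m" for f using that S(2)[OF m that] m by auto
  then show ?thesis using S(3)[OF m] by simp
qed


text \<open>The two exponents differ by column \<open>k\<close>. It is not zero, because its pairing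
  with \<open>unitv k\<close> is \<open>D k > 0\<close>; so independence applies to two distinct
  monomials.\<close>

lemma mutated_var_nonzero:
  fixes B :: "'n::finite \<Rightarrow> 'n \<Rightarrow> int"
  assumes ind: "indep M" and c: "compat L B D ex" and k: "k \<in> ex"
  shows "M (\<lambda>i. - unitv k i + max (B i k) 0) + M (\<lambda>i. - unitv k i - min (B i k) 0) \<noteq> 0"
    (is "M ?a + M ?b \<noteq> 0")
proof
  assume zero: "M ?a + M ?b = 0"
  have "?a \<noteq> ?b"
  proof
    assume eq: "?a = ?b"
    have "B i k = 0" for i
      using fun_cong[OF eq, of i] by (simp add: max_def min_def split: if_splits)
    then have "bil L (\<lambda>i. B i k) (unitv k) = 0" by simp
    then show False
      using compat_bil_column[OF c k, of "unitv k"] c k by (auto simp: unitv_def compat_def)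
  qed
  then have "(\<Sum>f\<in>{?a, ?b}. 1 * M f) = 0" using zero by simp
  then have "\<forall>f\<in>{?a, ?b}. (1::'k) = 0"
    using ind[unfolded indep_def, rule_format, of "{?a, ?b}" "\<lambda>_. 1"] one_in by blast
  then have "(1::'k) = 0" by blast
  then show False by simp
qed

text \<open>Writing \<open>f = f' + m e\<^sub>k\<close> with \<open>f'\<close> vanishing at \<open>k\<close>, the mutated frame must satisfy
  \<open>N(f') N(m e\<^sub>k) = s(\<Lambda>'(f', m e\<^sub>k)) N(f)\<close> with \<open>N(f') = M(f')\<close> and \<open>N(m e\<^sub>k) = X\<^sup>m\<close>. Its
  independence follows from the grading by the \<open>k\<close>-th exponent, in which \<open>X\<close> has degree \<open>-1\<close>.\<close>

lemma mutated_frame: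
  fixes B :: "'n::finite \<Rightarrow> 'n \<Rightarrow> int"
  assumes M: "mult_rel s L M" and skew: "\<forall>i j. L i j = - L j i"
    and ind: "indep M" and c: "compat L B D ex" and k: "k \<in> ex"
  defines "X \<equiv> M (\<lambda>i. - unitv k i + max (B i k) 0) + M (\<lambda>i. - unitv k i - min (B i k) 0)"
  defines "L' \<equiv> mut_L L B k"
  defines "N \<equiv> (\<lambda>f. s (- bil L' (f(k := 0)) (\<lambda>i. f k * unitv k i)) * (M (f(k := 0)) * X powi f k))"
  shows "mult_rel s L' N" "\<And>j. j \<noteq> k \<Longrightarrow> N (unitv j) = M (unitv j)" "N (unitv k) = X"
    "indep N"
proof -
  let ?a = "\<lambda>i. - unitv k i + max (B i k) 0" and ?b = "\<lambda>i. - unitv k i - min (B i k) 0"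
  have X: "X = M ?a + M ?b" by (simp add: X_def)
  have Xnz: "X \<noteq> 0" unfolding X by (rule mutated_var_nonzero[OF ind c k])
  have Bkk: "B k k = 0" by (rule compat_diag_zero[OF c k])
  have skew': "\<forall>i j. L' i j = - L' j i" unfolding L'_def by (rule mut_L_skew[OF skew])
  have vec: "mut_vec B k g = g" if "g k = 0" for g
    using that by (auto simp: mut_vec_eq)
  have vec_k: "mut_vec B k (unitv k) = ?b"
    using Bkk by (auto simp: mut_vec_eq unitv_def max_def min_def)
  have L'0: "bil L' f g = bil L f g" if "f k = 0" "g k = 0" for f g
    unfolding L'_def bil_mut_L using that by (simp add: vec)
  \<comment> \<open>The difference of the exponents is column \<open>k\<close>, orthogonal to
    \<open>g\<close>. Hence \<open>X\<close> commutes with \<open>M g\<close> up to a scalar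
    although it is a sum of two monomials.\<close>
  have a_b: "bil L ?a g = bil L ?b g" if "g k = 0" for g
  proof -
    have "?a = (\<lambda>i. ?b i + B i k)" by (auto simp: max_def min_def)
    then show ?thesis
      using bil_add_left[of L ?b "\<lambda>i. B i k" g] that by (simp add: compat_bil_column[OF c k])
  qed
  have L'k: "bil L' (unitv k) g = bil L ?b g" if "g k = 0" for g
    unfolding L'_def bil_mut_L vec_k using that by (simp add: vec)
  have XM: "X * M g = s (2 * bil L' (unitv k) g) * (M g * X)" if "g k = 0" for g
    using frame_comm[OF M skew, of ?a g] frame_comm[OF M skew, of ?b g] a_b[of g, OF that] L'k[of g, OF that]
    by (simp add: X distrib_left distrib_right)
  have XmM: "X powi m * M g = s (m * (2 * bil L' (unitv k) g)) * (M g * X powi m)" if "g k = 0" for g m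
    by (rule power_int_skew_commute[OF XM[of g, OF that] Xnz])
  have add_upd: "(\<lambda>i. f i + g i)(k := 0) = (\<lambda>i. (f(k := 0)) i + (g(k := 0)) i)" for f g :: "'n \<Rightarrow> int"
    by auto
  show mult: "mult_rel s L' N"
    unfolding mult_rel_def
  proof (intro conjI allI)
    show "N (\<lambda>_. 0) = 1"
      using frame_zero[OF M] by (simp add: N_def fun_upd_def)
    fix f g :: "'n \<Rightarrow> int"
    define f' where "f' = f(k := 0)"
    define g' where "g' = g(k := 0)"
    define m where "m = f k"
    define n where "n = g k"
    have fg0: "f' k = 0" "g' k = 0" by (simp_all add: f'_def g'_def)
    let ?e = "unitv k"
    let ?\<beta> = "bil L'"
    have f: "f = (\<lambda>i. f' i + m * ?e i)" by (auto simp: f'_def m_def unitv_def)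
    have g: "g = (\<lambda>i. g' i + n * ?e i)" by (auto simp: g'_def n_def unitv_def)
    have Nf: "N f = s (- (m * ?\<beta> f' ?e)) * (M f' * X powi m)"
      by (simp add: N_def f'_def m_def bil_scale_right)
    have Ng: "N g = s (- (n * ?\<beta> g' ?e)) * (M g' * X powi n)"
      by (simp add: N_def g'_def n_def bil_scale_right)
    have Nfg: "N (\<lambda>i. f i + g i) = s (- ((m + n) * (?\<beta> f' ?e + ?\<beta> g' ?e)))
        * (M (\<lambda>i. f' i + g' i) * X powi (m + n))"
      unfolding N_def add_upd f'_def[symmetric] g'_def[symmetric] m_def[symmetric] n_def[symmetric]
        bil_scale_right bil_add_left ..
    have "N f * N g = s (- (m * ?\<beta> f' ?e) - n * ?\<beta> g' ?e) * (M f' * (X powi m * M g') * X powi n)"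
      unfolding Nf Ng
      by (simp add: s_comm_left[of "M f'"] s_comm_left[of "X powi m"] mult.assoc s_cancel)
    also have "\<dots> = s (- (m * ?\<beta> f' ?e) - n * ?\<beta> g' ?e + m * (2 * ?\<beta> ?e g'))
        * (M f' * M g' * (X powi m * X powi n))"
      unfolding XmM[of g' m, OF fg0(2)]
      by (simp add: s_comm_left[of "M f'"] mult.assoc s_cancel)
    also have "\<dots> = s (- (m * ?\<beta> f' ?e) - n * ?\<beta> g' ?e + m * (2 * ?\<beta> ?e g') + ?\<beta> f' g')
        * (M (\<lambda>i. f' i + g' i) * X powi (m + n))"
      using Xnz by (simp add: frame_mult[OF M, of f' g'] L'0 fg0 mult.assoc s_cancel power_int_add)
    also have "- (m * ?\<beta> f' ?e) - n * ?\<beta> g' ?e + m * (2 * ?\<beta> ?e g') + ?\<beta> f' g'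
        = ?\<beta> f g - (m + n) * (?\<beta> f' ?e + ?\<beta> g' ?e)"
    proof -
      have "?\<beta> f g = ?\<beta> f' g' + n * ?\<beta> f' ?e + m * ?\<beta> ?e g'"
        unfolding f g bil_add_left bil_add_right bil_scale_left bil_scale_right bil_self[OF skew']
        by (simp add: algebra_simps)
      then show ?thesis
        unfolding bil_swap[OF skew', of g' ?e] by (simp add: algebra_simps)
    qed
    finally show "N f * N g = s (?\<beta> f g) * N (\<lambda>i. f i + g i)"
      unfolding Nfg by (simp add: s_cancel)
  qed
  show "N (unitv j) = M (unitv j)" if "j \<noteq> k" for j
  proof -
    have "(unitv j)(k := 0) = unitv j" "unitv j k = 0" using that by (auto simp: unitv_def)
    then show ?thesis by (simp add: N_def)
  qed
  show "N (unitv k) = X"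
  proof -
    have "(unitv k)(k := 0) = (\<lambda>_. 0)" "unitv k k = 1" by (auto simp: unitv_def)
    then show ?thesis using frame_zero[OF M] by (simp add: N_def)
  qed
  show "indep N"
    unfolding indep_def
  proof (intro allI impI)
    fix S :: "('n \<Rightarrow> int) set" and c :: "('n \<Rightarrow> int) \<Rightarrow> 'k"
    assume S: "finite S" and cC: "\<forall>f\<in>S. c f \<in> C" and zero: "(\<Sum>f\<in>S. c f * N f) = 0"
    define \<sigma> where "\<sigma> = (\<lambda>f. s (- bil L' (f(k := 0)) (\<lambda>i. f k * unitv k i)))"
    \<comment> \<open>Negative powers of \<open>X\<close> need not lie in the span of the monomials,
      so a power of \<open>X\<close> clears them first. The 0 in the maximum covers an empty
      \<open>S\<close>.\<close>
    obtain n :: int where n: "\<forall>f\<in>S. f k + n \<ge> 0"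
    proof
      have "- f k \<le> Max (insert 0 ((\<lambda>f. - f k) ` S))" if "f \<in> S" for f
        using that S by (intro Max_ge) auto
      then show "\<forall>f\<in>S. f k + Max (insert 0 ((\<lambda>f. - f k) ` S)) \<ge> 0" by force
    qed
    define T where "T = (\<lambda>f. c f * \<sigma> f * M (f(k := 0)))"
    have T: "c f * N f * X powi n = T f * X ^ nat (f k + n)" if "f \<in> S" for f
      using n that Xnz power_int_add[of X "f k" n]
      by (simp add: N_def T_def \<sigma>_def mult.assoc power_int_def)
    have "X \<in> homog k M (- 1)"
    proof -
      have "1 * M ?a \<in> homog k M (- 1)" "1 * M ?b \<in> homog k M (- 1)"
        using Bkk by (intro homog_gen one_in; simp add: unitv_def)+
      then show ?thesis unfolding X by (simp add: homog_add)
    qed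
    then have X_pow: "X ^ nat (f k + n) \<in> homog k M (- (f k + n))" if "f \<in> S" for f
      using homog_power[OF M, of X k "- 1" "nat (f k + n)"] n that by simp
    have T_homog: "T f \<in> homog k M 0" if "f \<in> S" for f
      unfolding T_def \<sigma>_def using cC that by (intro homog_gen mult_in s_in) auto
    define Y where "Y = (\<lambda>m. \<Sum>f\<in>{f\<in>S. - (f k + n) = m}. T f * X ^ nat (f k + n))"
    have "(\<Sum>m\<in>(\<lambda>f. - (f k + n)) ` S. Y m) = (\<Sum>f\<in>S. T f * X ^ nat (f k + n))"
      unfolding Y_def by (rule sum.image_gen[OF S, symmetric])
    also have "\<dots> = (\<Sum>f\<in>S. c f * N f) * X powi n"
      unfolding sum_distrib_right by (rule sum.cong) (simp_all add: T)
    finally have Y0: "(\<Sum>m\<in>(\<lambda>f. - (f k + n)) ` S. Y m) = 0" using zero by simp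
    have Y_homog: "Y m \<in> homog k M m" for m
      unfolding Y_def using homog_mult[OF M T_homog X_pow]
      by (intro homog_sum) force
    show "\<forall>f\<in>S. c f = 0"
    proof
      fix f0 assume f0: "f0 \<in> S"
      define m where "m = f0 k"
      define S' where "S' = {f\<in>S. f k = m}"
      have "Y (- (m + n)) = 0"
        by (rule homog_independent[OF ind _ Y_homog Y0]) (use S f0 in \<open>auto simp: m_def\<close>)
      moreover have "Y (- (m + n)) = (\<Sum>f\<in>S'. T f) * X ^ nat (m + n)"
        unfolding Y_def S'_def sum_distrib_right by (rule sum.cong) auto
      ultimately have T0: "(\<Sum>f\<in>S'. T f) = 0" using Xnz by simp
      \<comment> \<open>On \<open>S'\<close> the \<open>k\<close>-th exponent is constantly
        \<open>m\<close>, so setting it to 0 loses nothing; \<open>c'\<close> restores it to find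
        the coefficient of a truncated exponent.\<close>
      define c' where "c' = (\<lambda>g. c (g(k := m)) * \<sigma> (g(k := m)))"
      have upd: "f(k := m) = f" if "f \<in> S'" for f using that by (auto simp: S'_def)
      have inj: "inj_on (\<lambda>f. f(k := 0)) S'"
      proof (rule inj_onI)
        fix f g assume fg: "f \<in> S'" "g \<in> S'" "f(k := 0) = g(k := 0)"
        then have "(f(k := 0))(k := m) = (g(k := 0))(k := m)" by simp
        then show "f = g" using upd[OF fg(1)] upd[OF fg(2)] by simp
      qed
      have "(\<Sum>g\<in>(\<lambda>f. f(k := 0)) ` S'. c' g * M g) = (\<Sum>f\<in>S'. T f)"
        unfolding sum.reindex[OF inj] by (rule sum.cong) (auto simp: c'_def T_def upd)
      then have "(\<Sum>g\<in>(\<lambda>f. f(k := 0)) ` S'. c' g * M g) = 0" using T0 by simp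
      moreover have "finite ((\<lambda>f. f(k := 0)) ` S')" using S by (simp add: S'_def)
      moreover have "c' g \<in> C" if "g \<in> (\<lambda>f. f(k := 0)) ` S'" for g
        using that cC by (auto simp: c'_def upd \<sigma>_def S'_def intro!: mult_in s_in)
      ultimately have "\<forall>g\<in>(\<lambda>f. f(k := 0)) ` S'. c' g = 0"
        using ind[unfolded indep_def, rule_format, of "(\<lambda>f. f(k := 0)) ` S'" c'] by blast
      then have "c f0 * \<sigma> f0 = 0"
        using f0 by (auto simp: c'_def S'_def m_def)
      then show "c f0 = 0" by (simp add: \<sigma>_def)
    qed
  qed
qed

text \<open>Resolves the definite description with the explicit frame of
  \<open>mutated_frame\<close>. The preserved independence makes the result applicable to the next
  mutation.\<close>

lemma mut_M_frame:
  fixes B :: "'n::finite \<Rightarrow> 'n \<Rightarrow> int"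
  assumes M: "mult_rel s L M" and skew: "\<forall>i j. L i j = - L j i"
    and ind: "indep M" and c: "compat L B D ex" and k: "k \<in> ex"
  shows "mult_rel s (mut_L L B k) (mut_M s L B k M)"
    and "\<And>j. j \<noteq> k \<Longrightarrow> mut_M s L B k M (unitv j) = M (unitv j)"
    and "mut_M s L B k M (unitv k)
      = M (\<lambda>i. - unitv k i + max (B i k) 0) + M (\<lambda>i. - unitv k i - min (B i k) 0)"
    and "indep (mut_M s L B k M)"
proof -
  note N = mutated_frame[OF M skew ind c k]
  have "mut_M s L B k M = (\<lambda>f. s (- bil (mut_L L B k) (f(k := 0)) (\<lambda>i. f k * unitv k i)) * (M (f(k := 0))
    * (M (\<lambda>i. - unitv k i + max (B i k) 0) + M (\<lambda>i. - unitv k i - min (B i k) 0)) powi f k))"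
    (is "_ = ?N")
    unfolding mut_M_def
  proof (rule the_equality)
    show "mult_rel s (mut_L L B k) ?N \<and> (\<forall>j. j \<noteq> k \<longrightarrow> ?N (unitv j) = M (unitv j))
        \<and> ?N (unitv k) = M (\<lambda>i. - unitv k i + max (B i k) 0) + M (\<lambda>i. - unitv k i - min (B i k) 0)"
      using N(1-3) by blast
    fix M'
    assume M': "mult_rel s (mut_L L B k) M' \<and> (\<forall>j. j \<noteq> k \<longrightarrow> M' (unitv j) = M (unitv j))
        \<and> M' (unitv k) = M (\<lambda>i. - unitv k i + max (B i k) 0) + M (\<lambda>i. - unitv k i - min (B i k) 0)"
    show "M' = ?N"
    proof (rule frame_unique)
      show "mult_rel s (mut_L L B k) M'" using M' by blast
      show "mult_rel s (mut_L L B k) ?N" by (rule N(1))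
      show "M' (unitv j) = ?N (unitv j)" for j
        using M' N(2)[of j] N(3) by (cases "j = k") metis+
    qed
  qed
  then show "mult_rel s (mut_L L B k) (mut_M s L B k M)"
    and "\<And>j. j \<noteq> k \<Longrightarrow> mut_M s L B k M (unitv j) = M (unitv j)"
    and "mut_M s L B k M (unitv k)
      = M (\<lambda>i. - unitv k i + max (B i k) 0) + M (\<lambda>i. - unitv k i - min (B i k) 0)"
    and "indep (mut_M s L B k M)"
    using N by simp_all
qed

end

section \<open>Specialization\<close>

lemma eval_int_poly_sum: "eval_int_poly (\<Sum>i\<in>A. p i) x = (\<Sum>i\<in>A. eval_int_poly (p i) x)"
  by (induction A rule: infinite_finite_induct) simp_all

lemma eval_int_poly_central:
  assumes "\<And>y. x * y = y * x"
  shows "eval_int_poly p x * y = y * eval_int_poly p x"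
proof (induction p)
  case (pCons a p)
  have "x * eval_int_poly p x * y = y * (x * eval_int_poly p x)"
    by (metis assms mult.assoc pCons.IH)
  then show ?case by (simp add: distrib_left distrib_right mult_of_int_commute)
qed simp

lemma power_int_central:
  fixes x :: "'a :: division_ring"
  assumes "\<And>y. x * y = y * x"
  shows "x powi m * y = y * x powi m"
proof -
  have pow: "x ^ n * y = y * x ^ n" for n y
    by (rule power_commuting_commutes) (rule assms)
  have inv: "inverse z * y = y * inverse z" if "\<And>y. z * y = y * z" for z y :: 'a
  proof (cases "z = 0")
    case False
    have "inverse z * y = inverse z * (y * z) * inverse z"
      using False by (simp add: mult.assoc)
    also have "\<dots> = y * inverse z"
      using False by (simp add: that[symmetric] mult.assoc[symmetric])
    finally show ?thesis .
  qed simp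
  show ?thesis
    by (cases m rule: int_cases4) (simp_all add: pow inv power_int_minus)
qed

text \<open>Clears denominators, so that questions on Laurent polynomials become divisibility
  questions for integer polynomials.\<close>

lemma laurent_sum_eq:
  fixes x :: "'a :: division_ring"
  assumes "x \<noteq> 0" "\<And>a. a \<in> A \<Longrightarrow> - int N \<le> a"
  shows "(\<Sum>a\<in>A. of_int (n a) * x powi a)
    = x powi (- int N) * eval_int_poly (\<Sum>a\<in>A. monom (n a) (nat (a + int N))) x"
  unfolding eval_int_poly_sum sum_distrib_left
proof (rule sum.cong)
  fix a assume a: "a \<in> A"
  have "x ^ nat (a + int N) = x powi (a + int N)"
    using assms(2)[OF a] by (simp add: power_int_def)
  then have "x powi (- int N) * (of_int (n a) * x ^ nat (a + int N))
      = of_int (n a) * (x powi (- int N) * x powi (a + int N))"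
    by (metis mult.assoc mult_of_int_commute)
  also have "x powi (- int N) * x powi (a + int N) = x powi a"
    using power_int_add[of x "- int N" "a + int N"] assms(1) by simp
  finally show "of_int (n a) * x powi a
      = x powi (- int N) * eval_int_poly (monom (n a) (nat (a + int N))) x"
    by simp
qed simp

lemma Aq_scal_iff:
  fixes t :: "'k :: division_ring"
  assumes "t \<noteq> 0"
  shows "x \<in> Aq_scal t \<longleftrightarrow> (\<exists>N p. x = t powi (- int N) * eval_int_poly p t)"
proof
  assume "x \<in> Aq_scal t"
  then obtain n :: "int \<Rightarrow> int" where n: "finite {a. n a \<noteq> 0}" "x = (\<Sum>a\<in>{a. n a \<noteq> 0}. of_int (n a) * t powi a)"
    unfolding Aq_scal_def by blast
  \<comment> \<open>Inserting 0 keeps the maximum meaningful for an empty support and makes it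
    nonnegative, so \<open>nat\<close> loses nothing.\<close>
  define N where "N = nat (Max (insert 0 (uminus ` {a. n a \<noteq> 0})))"
  have "- int N \<le> a" if "a \<in> {a. n a \<noteq> 0}" for a
  proof -
    have "- a \<le> Max (insert 0 (uminus ` {a. n a \<noteq> 0}))"
      using that n(1) by (intro Max_ge) auto
    then show ?thesis by (simp add: N_def)
  qed
  then show "\<exists>N p. x = t powi (- int N) * eval_int_poly p t"
    unfolding n(2) using laurent_sum_eq[OF assms] by blast
next
  assume "\<exists>N p. x = t powi (- int N) * eval_int_poly p t"
  then obtain N p where x: "x = t powi (- int N) * eval_int_poly p t" by blast
  define n where "n = (\<lambda>a. if a + int N \<ge> 0 then coeff p (nat (a + int N)) else 0)"
  define A where "A = (\<lambda>i. int i - int N) ` {..degree p}"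
  have supp: "{a. n a \<noteq> 0} \<subseteq> A"
  proof
    fix a assume "a \<in> {a. n a \<noteq> 0}"
    then have a: "a + int N \<ge> 0" "coeff p (nat (a + int N)) \<noteq> 0"
      by (auto simp: n_def split: if_splits)
    then show "a \<in> A"
      unfolding A_def by (intro image_eqI[of _ _ "nat (a + int N)"]) (auto intro: le_degree)
  qed
  have fin: "finite A" by (simp add: A_def)
  have "x = (\<Sum>i\<le>degree p. of_int (coeff p i) * t powi (int i - int N))"
    unfolding x eval_int_poly_def sum_distrib_left
  proof (rule sum.cong)
    fix i
    have "t powi (int i - int N) = t powi (- int N) * t ^ i"
      using power_int_add[of t "- int N" "int i"] assms by simp
    then show "t powi (- int N) * (of_int (coeff p i) * t ^ i)
        = of_int (coeff p i) * t powi (int i - int N)"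
      by (metis mult.assoc mult_of_int_commute)
  qed simp
  also have "\<dots> = (\<Sum>a\<in>A. of_int (n a) * t powi a)"
    unfolding A_def by (subst sum.reindex) (auto simp: inj_on_def n_def)
  also have "\<dots> = (\<Sum>a\<in>{a. n a \<noteq> 0}. of_int (n a) * t powi a)"
    by (rule sum.mono_neutral_right) (use fin supp in auto)
  finally show "x \<in> Aq_scal t"
    unfolding Aq_scal_def using finite_subset[OF supp fin] by blast
qed

lemma Aeps_iff: "x \<in> Aeps w \<longleftrightarrow> (\<exists>p. x = eval_int_poly p w)"
proof
  assume "x \<in> Aeps w"
  then obtain n :: "nat \<Rightarrow> int" and m where "x = (\<Sum>a<m. of_int (n a) * w ^ a)"
    unfolding Aeps_def by blast
  then have "x = eval_int_poly (\<Sum>a<m. monom (n a) a) w"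
    by (simp add: eval_int_poly_sum)
  then show "\<exists>p. x = eval_int_poly p w" by blast
next
  assume "\<exists>p. x = eval_int_poly p w"
  then obtain p where "x = eval_int_poly p w" by blast
  then have "x = (\<Sum>a<Suc (degree p). of_int (coeff p a) * w ^ a)"
    by (simp only: eval_int_poly_def lessThan_Suc_atMost)
  then show "x \<in> Aeps w" unfolding Aeps_def by blast
qed

lemma Aeps_add: "x \<in> Aeps w \<Longrightarrow> y \<in> Aeps w \<Longrightarrow> x + y \<in> Aeps w"
  unfolding Aeps_iff by (metis eval_int_poly_add)

lemma Aeps_mult: "x \<in> Aeps w \<Longrightarrow> y \<in> Aeps w \<Longrightarrow> x * y \<in> Aeps w"
  unfolding Aeps_iff by (metis eval_int_poly_mult)

lemma Aeps_of_int: "of_int n \<in> Aeps w"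
  unfolding Aeps_iff by (rule exI[of _ "[:n:]"]) simp

lemma Aeps_0: "0 \<in> Aeps w" and Aeps_1: "1 \<in> Aeps w"
  using Aeps_of_int[of 0] Aeps_of_int[of 1] by simp_all

lemma Aeps_sum: "(\<And>i. i \<in> A \<Longrightarrow> g i \<in> Aeps w) \<Longrightarrow> sum g A \<in> Aeps w"
  by (induction A rule: infinite_finite_induct) (auto intro: Aeps_0 Aeps_add)

lemma Aeps_power: "x \<in> Aeps w \<Longrightarrow> x ^ n \<in> Aeps w"
  by (induction n) (auto intro: Aeps_1 Aeps_mult)

text \<open>The inverse of a root of unity is one of its nonnegative powers, so no inverses need to
  be adjoined on this side.\<close>

lemma Aeps_power_int:
  assumes "l > 0" "w ^ l = 1"
  shows "w powi a \<in> Aeps w"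
proof -
  have w: "w \<in> Aeps w" unfolding Aeps_iff by (rule exI[of _ "[:0, 1:]"]) simp
  have "w * w ^ (l - 1) = 1" using assms by (simp flip: power_Suc)
  then have "inverse w = w ^ (l - 1)" by (rule inverse_unique)
  then show ?thesis unfolding power_int_def using w by (auto intro!: Aeps_power)
qed

text \<open>Sums in \<open>qframe\<close> and \<open>kappa\<close> run over the exact support of a
  coefficient array. To add or compare two of them, both are spread over a common rectangle
  \<open>A \<times> S\<close>.\<close>

lemma sum_support_swap:
  assumes "finite A" "finite S" "{(a, f). c a f \<noteq> 0} \<subseteq> A \<times> S"
    and "\<And>a f. c a f = 0 \<Longrightarrow> g a f = 0"
  shows "(\<Sum>(a, f)\<in>{(a, f). c a f \<noteq> 0}. g a f) = (\<Sum>f\<in>S. \<Sum>a\<in>A. g a f)"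
proof -
  have "(\<Sum>(a, f)\<in>{(a, f). c a f \<noteq> 0}. g a f) = (\<Sum>(a, f)\<in>A \<times> S. g a f)"
    by (rule sum.mono_neutral_left) (use assms in auto)
  also have "\<dots> = (\<Sum>a\<in>A. \<Sum>f\<in>S. g a f)" by (simp add: sum.cartesian_product)
  also have "\<dots> = (\<Sum>f\<in>S. \<Sum>a\<in>A. g a f)" by (rule sum.swap)
  finally show ?thesis .
qed

lemma gen_alg_sum:
  assumes "0 \<in> S" "\<And>i. i \<in> A \<Longrightarrow> g i \<in> gen_alg S G"
  shows "sum g A \<in> gen_alg S G"
  using assms(2)
  by (induction A rule: infinite_finite_induct) (auto intro: gen_alg.scal gen_alg.add assms(1))

locale specialization =
  fixes l :: nat and w :: complex
    and \<iota> :: "complex \<Rightarrow> 'f::division_ring" and M :: "('n::finite \<Rightarrow> int) \<Rightarrow> 'f"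
    and t :: "'k::division_ring" and Mq :: "('n \<Rightarrow> int) \<Rightarrow> 'k"
    and L :: "'n \<Rightarrow> 'n \<Rightarrow> int"
  assumes l_pos: "l > 0"
    and w_prim: "w ^ l = 1" "\<forall>m. 0 < m \<and> m < l \<longrightarrow> w ^ m \<noteq> 1"
    and skew: "\<forall>i j. L i j = - L j i"
    and eframe: "eframe \<iota> w L M"
    and qframe: "qframe t L Mq"
begin

lemma w_nonzero: "w \<noteq> 0"
  using w_prim(1) l_pos by (auto simp: power_0_left)

lemma Aeps_w: "w powi a \<in> Aeps w"
  by (rule Aeps_power_int[OF l_pos w_prim(1)])

lemma \<iota>_hom:
  "\<iota> 1 = 1" "x \<in> Aeps w \<Longrightarrow> y \<in> Aeps w \<Longrightarrow> \<iota> (x + y) = \<iota> x + \<iota> y"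
  "x \<in> Aeps w \<Longrightarrow> y \<in> Aeps w \<Longrightarrow> \<iota> (x * y) = \<iota> x * \<iota> y"
  "x \<in> Aeps w \<Longrightarrow> \<iota> x * z = z * \<iota> x"
  using eframe unfolding eframe_def by blast+

lemma \<iota>_0 [simp]: "\<iota> 0 = 0"
  using \<iota>_hom(2)[OF Aeps_0 Aeps_0] by simp

lemma \<iota>_sum: "(\<And>i. i \<in> A \<Longrightarrow> g i \<in> Aeps w) \<Longrightarrow> \<iota> (sum g A) = (\<Sum>i\<in>A. \<iota> (g i))"
  by (induction A rule: infinite_finite_induct) (auto simp: \<iota>_hom(2) Aeps_sum)

lemma M_frame: "mult_rel (\<lambda>a. \<iota> (w powi a)) L M"
  using eframe unfolding eframe_def by blast

lemma Mq_frame: "mult_rel (\<lambda>a. t powi a) L Mq"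
  using qframe unfolding qframe_def by blast

lemma t_central: "t * x = x * t"
  using qframe unfolding qframe_def by blast

lemma Mq_independent:
  assumes "finite {(a, f). c a f \<noteq> 0}"
    and "(\<Sum>(a, f)\<in>{(a, f). c a f \<noteq> 0}. of_int (c a f) * t powi a * Mq f) = 0"
  shows "c a f = 0"
  using qframe assms unfolding qframe_def by blast

lemma Mq_independent_sum:
  assumes "finite A" "finite S"
    and "(\<Sum>f\<in>S. \<Sum>a\<in>A. of_int (c a f) * t powi a * Mq f) = 0"
    and "a \<in> A" "f \<in> S"
  shows "c a f = 0"
proof -
  define d where "d = (\<lambda>a f. if a \<in> A \<and> f \<in> S then c a f else 0)"
  have supp: "{(a, f). d a f \<noteq> 0} \<subseteq> A \<times> S" by (auto simp: d_def split: if_splits)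
  have "(\<Sum>(a, f)\<in>{(a, f). d a f \<noteq> 0}. of_int (d a f) * t powi a * Mq f)
      = (\<Sum>f\<in>S. \<Sum>a\<in>A. of_int (d a f) * t powi a * Mq f)"
    by (rule sum_support_swap[OF assms(1,2) supp]) simp
  also have "\<dots> = (\<Sum>f\<in>S. \<Sum>a\<in>A. of_int (c a f) * t powi a * Mq f)"
    by (intro sum.cong refl) (simp add: d_def)
  finally have "d a f = 0"
    using assms(3) supp assms(1,2)
    by (intro Mq_independent) (auto intro: finite_subset)
  then show ?thesis using assms(4,5) by (simp add: d_def)
qed

text \<open>Transcendence of \<open>t\<close>: the part of the frame's independence at exponent 0,
  where \<open>Mq\<close> is 1.\<close>

lemma t_independent:
  assumes "finite A" "(\<Sum>a\<in>A. of_int (n a) * t powi a) = 0" "a \<in> A"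
  shows "n a = 0"
proof -
  have "Mq (\<lambda>_. 0) = 1" using Mq_frame by (simp add: mult_rel_def)
  then show ?thesis
    using Mq_independent_sum[of A "{\<lambda>_. 0}" "\<lambda>a f. n a" a "\<lambda>_. 0"] assms by simp
qed

lemma t_nonzero: "t \<noteq> 0"
  using t_independent[of "{1}" "\<lambda>_. 1" 1] by auto

sublocale Q: central_coeffs "Aq_scal t" "\<lambda>a. t powi a"
proof
  have iff: "x \<in> Aq_scal t \<longleftrightarrow> (\<exists>N p. x = t powi (- int N) * eval_int_poly p t)" for x
    by (rule Aq_scal_iff[OF t_nonzero])
  have tp: "t powi m * x = x * t powi m" for m x
    by (rule power_int_central[OF t_central])
  have ev: "eval_int_poly p t * x = x * eval_int_poly p t" for p x
    by (rule eval_int_poly_central[OF t_central])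
  show "c * x = x * c" if "c \<in> Aq_scal t" for c x
    using that unfolding iff by (metis tp ev mult.assoc)
  show "0 \<in> Aq_scal t" unfolding iff by (intro exI[of _ 0]) simp
  show "c * d \<in> Aq_scal t" if cd: "c \<in> Aq_scal t" "d \<in> Aq_scal t" for c d
  proof -
    obtain N p N' p' where c: "c = t powi (- int N) * eval_int_poly p t"
      and d: "d = t powi (- int N') * eval_int_poly p' t"
      using cd unfolding iff by blast
    have "c * d = t powi (- int N) * (eval_int_poly p t * t powi (- int N')) * eval_int_poly p' t"
      by (simp add: c d mult.assoc)
    also have "\<dots> = (t powi (- int N) * t powi (- int N')) * (eval_int_poly p t * eval_int_poly p' t)"
      unfolding ev[of p "t powi _"] by (simp add: mult.assoc)
    also have "\<dots> = t powi (- int (N + N')) * eval_int_poly (p * p') t"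
    proof -
      have "t powi (- int (N + N')) = t powi (- int N) * t powi (- int N')"
        using power_int_add[of t "- int N" "- int N'"] t_nonzero by simp
      then show ?thesis by simp
    qed
    finally show ?thesis unfolding iff by blast
  qed
  show "c + d \<in> Aq_scal t" if cd: "c \<in> Aq_scal t" "d \<in> Aq_scal t" for c d
  proof -
    obtain N p N' p' where c: "c = t powi (- int N) * eval_int_poly p t"
      and d: "d = t powi (- int N') * eval_int_poly p' t"
      using cd unfolding iff by blast
    have shift: "t powi (- int N) = t powi (- int (N + K)) * t ^ K" for N K
      using power_int_add[of t "- int (N + K)" "int K"] t_nonzero by simp
    have "c + d = t powi (- int (N + N')) * (t ^ N' * eval_int_poly p t + t ^ N * eval_int_poly p' t)"
      unfolding c d shift[of N N'] shift[of N' N] by (simp add: distrib_left mult.assoc add.commute)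
    also have "\<dots> = t powi (- int (N + N')) * eval_int_poly (monom 1 N' * p + monom 1 N * p') t"
      by simp
    finally show ?thesis unfolding iff by blast
  qed
  show "t powi a \<in> Aq_scal t" for a
  proof (cases a rule: int_cases4)
    case (nonneg n)
    then show ?thesis unfolding iff
      by (intro exI[of _ 0] exI[of _ "monom 1 n"]) simp
  next
    case (neg n)
    then show ?thesis unfolding iff
      by (intro exI[of _ n] exI[of _ 1]) simp
  qed
  show "t powi (a + b) = t powi a * t powi b" for a b
    using t_nonzero by (simp add: power_int_add)
qed simp

sublocale E: central_coeffs "\<iota> ` Aeps w" "\<lambda>a. \<iota> (w powi a)"
proof
  show "0 \<in> \<iota> ` Aeps w" using Aeps_0 \<iota>_0 by (metis image_eqI)
  show "c * x = x * c" if "c \<in> \<iota> ` Aeps w" for c x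
    using that \<iota>_hom(4) by blast
  show "c + d \<in> \<iota> ` Aeps w" if "c \<in> \<iota> ` Aeps w" "d \<in> \<iota> ` Aeps w" for c d
    using that \<iota>_hom(2) Aeps_add by (smt (verit) image_iff)
  show "c * d \<in> \<iota> ` Aeps w" if "c \<in> \<iota> ` Aeps w" "d \<in> \<iota> ` Aeps w" for c d
    using that \<iota>_hom(3) Aeps_mult by (smt (verit) image_iff)
  show "\<iota> (w powi a) \<in> \<iota> ` Aeps w" for a using Aeps_w by blast
  show "\<iota> (w powi (a + b)) = \<iota> (w powi a) * \<iota> (w powi b)" for a b
    using w_nonzero \<iota>_hom(3)[OF Aeps_w Aeps_w] by (simp add: power_int_add)
qed (simp add: \<iota>_hom(1))

lemma Aq_scal_of_int: "of_int n \<in> Aq_scal t"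
  unfolding Aq_scal_iff[OF t_nonzero] by (intro exI[of _ 0] exI[of _ "[:n:]"]) simp

lemma M_independent_sum:
  assumes "finite S" "\<And>f. f \<in> S \<Longrightarrow> d f \<in> Aeps w" "(\<Sum>f\<in>S. \<iota> (d f) * M f) = 0" "f \<in> S"
  shows "d f = 0"
proof -
  define e where "e = (\<lambda>f. if f \<in> S then d f else 0)"
  have supp: "{f. e f \<noteq> 0} \<subseteq> S" by (auto simp: e_def split: if_splits)
  have "(\<Sum>f\<in>{f. e f \<noteq> 0}. \<iota> (e f) * M f) = (\<Sum>f\<in>S. \<iota> (e f) * M f)"
    by (rule sum.mono_neutral_left) (use supp assms(1) in auto)
  also have "\<dots> = 0" using assms(3) by (simp add: e_def)
  finally have "(\<Sum>f\<in>{f. e f \<noteq> 0}. \<iota> (e f) * M f) = 0" .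
  moreover have "\<forall>f. e f \<in> Aeps w" using assms(2) Aeps_0 by (simp add: e_def)
  moreover have "finite {f. e f \<noteq> 0}" using supp assms(1) by (rule finite_subset)
  ultimately have "e f = 0" using eframe unfolding eframe_def by blast
  then show ?thesis using assms(4) by (simp add: e_def)
qed

lemma M_indep: "E.indep M"
  unfolding E.indep_def
proof (intro allI impI ballI)
  fix S :: "('n \<Rightarrow> int) set" and c f
  assume S: "finite S" "\<forall>f\<in>S. c f \<in> \<iota> ` Aeps w" "(\<Sum>f\<in>S. c f * M f) = 0" "f \<in> S"
  have "\<forall>f\<in>S. \<exists>x. x \<in> Aeps w \<and> c f = \<iota> x" using S(2) by blast
  then obtain d where d: "\<forall>f\<in>S. d f \<in> Aeps w \<and> c f = \<iota> (d f)"
    by (rule bchoice[THEN exE])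
  have "(\<Sum>f\<in>S. \<iota> (d f) * M f) = 0" using S(3) d by simp
  then have "d f = 0" using M_independent_sum[of S d f] S d by blast
  then show "c f = 0" using d S(4) by simp
qed

lemma Mq_indep: "Q.indep Mq"
  unfolding Q.indep_def
proof (intro allI impI ballI)
  fix S :: "('n \<Rightarrow> int) set" and c f
  assume S: "finite S" "\<forall>f\<in>S. c f \<in> Aq_scal t" "(\<Sum>f\<in>S. c f * Mq f) = 0" "f \<in> S"
  have "\<forall>f\<in>S. \<exists>n::int \<Rightarrow> int. finite {a. n a \<noteq> 0} \<and> c f = (\<Sum>a\<in>{a. n a \<noteq> 0}. of_int (n a) * t powi a)"
    using S(2) unfolding Aq_scal_def by simp
  then obtain n :: "('n \<Rightarrow> int) \<Rightarrow> int \<Rightarrow> int" where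
    n: "\<forall>f\<in>S. finite {a. n f a \<noteq> 0} \<and> c f = (\<Sum>a\<in>{a. n f a \<noteq> 0}. of_int (n f a) * t powi a)"
    by (rule bchoice[THEN exE])
  define A where "A = (\<Union>f\<in>S. {a. n f a \<noteq> 0})"
  have A: "finite A" using S(1) n by (simp add: A_def)
  have c: "c f = (\<Sum>a\<in>A. of_int (n f a) * t powi a)" if "f \<in> S" for f
  proof -
    have "c f = (\<Sum>a\<in>{a. n f a \<noteq> 0}. of_int (n f a) * t powi a)" using n that by blast
    also have "\<dots> = (\<Sum>a\<in>A. of_int (n f a) * t powi a)"
      by (rule sum.mono_neutral_left[OF A]) (use that in \<open>auto simp: A_def\<close>)
    finally show ?thesis .
  qed
  have "(\<Sum>f\<in>S. \<Sum>a\<in>A. of_int (n f a) * t powi a * Mq f) = (\<Sum>f\<in>S. c f * Mq f)"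
    by (rule sum.cong) (simp_all add: c sum_distrib_right)
  then have "n f a = 0" if "a \<in> A" for a
    using Mq_independent_sum[OF A S(1), of "\<lambda>a f. n f a" a f] S(3,4) that by simp
  then show "c f = 0" using c[OF S(4)] by simp
qed

end

lemma eval_int_poly_power_int:
  "eval_int_poly p x = (\<Sum>a\<in>int ` {..degree p}. of_int (coeff p (nat a)) * x powi a)"
  unfolding eval_int_poly_def by (subst sum.reindex) (auto simp: inj_on_def)

section \<open>The graph of the specialization map\<close>

context specialization
begin

text \<open>The graph of \<open>\<kappa>\<close> on the span of the \<open>Mq f\<close> with \<open>P f\<close>; working with the graph makes
  multiplicativity a computation with generators.\<close>

definition rel :: "(('n \<Rightarrow> int) \<Rightarrow> bool) \<Rightarrow> 'k \<Rightarrow> 'f \<Rightarrow> bool" where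
  "rel P x y \<longleftrightarrow> (\<exists>c :: int \<Rightarrow> ('n \<Rightarrow> int) \<Rightarrow> int. finite {(a, f). c a f \<noteq> 0} \<and> (\<forall>a f. c a f \<noteq> 0 \<longrightarrow> P f)
      \<and> x = (\<Sum>(a, f)\<in>{(a, f). c a f \<noteq> 0}. of_int (c a f) * t powi a * Mq f)
      \<and> y = (\<Sum>(a, f)\<in>{(a, f). c a f \<noteq> 0}. \<iota> (of_int (c a f) * w powi a) * M f))"

lemma rel_iff:
  "rel P x y \<longleftrightarrow> (\<exists>A S c. finite A \<and> finite S \<and> (\<forall>f\<in>S. P f)
      \<and> x = (\<Sum>f\<in>S. \<Sum>a\<in>A. of_int (c a f) * t powi a * Mq f)
      \<and> y = (\<Sum>f\<in>S. \<Sum>a\<in>A. \<iota> (of_int (c a f) * w powi a) * M f))"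
proof
  assume "rel P x y"
  then obtain c where c: "finite {(a, f). c a f \<noteq> 0}" "\<forall>a f. c a f \<noteq> 0 \<longrightarrow> P f"
      "x = (\<Sum>(a, f)\<in>{(a, f). c a f \<noteq> 0}. of_int (c a f) * t powi a * Mq f)"
      "y = (\<Sum>(a, f)\<in>{(a, f). c a f \<noteq> 0}. \<iota> (of_int (c a f) * w powi a) * M f)"
    unfolding rel_def by blast
  define A where "A = fst ` {(a, f). c a f \<noteq> 0}"
  define S where "S = snd ` {(a, f). c a f \<noteq> 0}"
  have fin: "finite A" "finite S" using c(1) by (simp_all add: A_def S_def)
  have supp: "{(a, f). c a f \<noteq> 0} \<subseteq> A \<times> S" by (force simp: A_def S_def)
  have "\<forall>f\<in>S. P f" using c(2) by (auto simp: S_def)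
  then show "\<exists>A S c. finite A \<and> finite S \<and> (\<forall>f\<in>S. P f)
      \<and> x = (\<Sum>f\<in>S. \<Sum>a\<in>A. of_int (c a f) * t powi a * Mq f)
      \<and> y = (\<Sum>f\<in>S. \<Sum>a\<in>A. \<iota> (of_int (c a f) * w powi a) * M f)"
    unfolding c(3,4) using fin
    by (intro exI[of _ A] exI[of _ S] exI[of _ c] conjI sum_support_swap[OF fin supp]) simp_all
next
  assume "\<exists>A S c. finite A \<and> finite S \<and> (\<forall>f\<in>S. P f)
      \<and> x = (\<Sum>f\<in>S. \<Sum>a\<in>A. of_int (c a f) * t powi a * Mq f)
      \<and> y = (\<Sum>f\<in>S. \<Sum>a\<in>A. \<iota> (of_int (c a f) * w powi a) * M f)"
  then obtain A S c where AS: "finite A" "finite S" "\<forall>f\<in>S. P f"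
      and x: "x = (\<Sum>f\<in>S. \<Sum>a\<in>A. of_int (c a f) * t powi a * Mq f)"
      and y: "y = (\<Sum>f\<in>S. \<Sum>a\<in>A. \<iota> (of_int (c a f) * w powi a) * M f)"
    by blast
  define d where "d = (\<lambda>a f. if a \<in> A \<and> f \<in> S then c a f else 0)"
  have supp: "{(a, f). d a f \<noteq> 0} \<subseteq> A \<times> S" by (auto simp: d_def split: if_splits)
  have "x = (\<Sum>(a, f)\<in>{(a, f). d a f \<noteq> 0}. of_int (d a f) * t powi a * Mq f)"
    by (subst sum_support_swap[OF AS(1,2) supp]) (auto simp: x d_def intro!: sum.cong)
  moreover have "y = (\<Sum>(a, f)\<in>{(a, f). d a f \<noteq> 0}. \<iota> (of_int (d a f) * w powi a) * M f)"
    by (subst sum_support_swap[OF AS(1,2) supp]) (auto simp: y d_def intro!: sum.cong)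
  moreover have "\<forall>a f. d a f \<noteq> 0 \<longrightarrow> P f" using AS(3) by (simp add: d_def)
  moreover have "finite {(a, f). d a f \<noteq> 0}" using supp AS(1,2) by (auto intro: finite_subset)
  ultimately show "rel P x y" unfolding rel_def by blast
qed

lemma rel_gen:
  assumes "P f"
  shows "rel P (of_int n * t powi a * Mq f) (\<iota> (of_int n * w powi a) * M f)"
  unfolding rel_iff
  by (rule exI[of _ "{a}"], rule exI[of _ "{f}"], rule exI[of _ "\<lambda>_ _. n"]) (simp add: assms)

lemma Aeps_term: "of_int n * w powi a \<in> Aeps w"
  by (intro Aeps_mult Aeps_of_int Aeps_w)

lemma rel_add:
  assumes "rel P x y" "rel P x' y'"
  shows "rel P (x + x') (y + y')"
proof -
  obtain c where c: "finite {(a, f). c a f \<noteq> 0}" "\<forall>a f. c a f \<noteq> 0 \<longrightarrow> P f"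
      "x = (\<Sum>(a, f)\<in>{(a, f). c a f \<noteq> 0}. of_int (c a f) * t powi a * Mq f)"
      "y = (\<Sum>(a, f)\<in>{(a, f). c a f \<noteq> 0}. \<iota> (of_int (c a f) * w powi a) * M f)"
    using assms(1) unfolding rel_def by blast
  obtain d where d: "finite {(a, f). d a f \<noteq> 0}" "\<forall>a f. d a f \<noteq> 0 \<longrightarrow> P f"
      "x' = (\<Sum>(a, f)\<in>{(a, f). d a f \<noteq> 0}. of_int (d a f) * t powi a * Mq f)"
      "y' = (\<Sum>(a, f)\<in>{(a, f). d a f \<noteq> 0}. \<iota> (of_int (d a f) * w powi a) * M f)"
    using assms(2) unfolding rel_def by blast
  define U where "U = {(a, f). c a f \<noteq> 0} \<union> {(a, f). d a f \<noteq> 0}"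
  define A where "A = fst ` U"
  define S where "S = snd ` U"
  have fin: "finite A" "finite S" using c(1) d(1) by (simp_all add: A_def S_def U_def)
  have suppc: "{(a, f). c a f \<noteq> 0} \<subseteq> A \<times> S" and suppd: "{(a, f). d a f \<noteq> 0} \<subseteq> A \<times> S"
    by (force simp: A_def S_def U_def)+
  have "\<forall>f\<in>S. P f" using c(2) d(2) by (auto simp: S_def U_def)
  moreover have "x + x' = (\<Sum>f\<in>S. \<Sum>a\<in>A. of_int (c a f + d a f) * t powi a * Mq f)"
  proof -
    have "x = (\<Sum>f\<in>S. \<Sum>a\<in>A. of_int (c a f) * t powi a * Mq f)"
      unfolding c(3) by (rule sum_support_swap[OF fin suppc]) simp
    moreover have "x' = (\<Sum>f\<in>S. \<Sum>a\<in>A. of_int (d a f) * t powi a * Mq f)"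
      unfolding d(3) by (rule sum_support_swap[OF fin suppd]) simp
    ultimately show ?thesis by (simp add: sum.distrib distrib_right)
  qed
  moreover have "y + y' = (\<Sum>f\<in>S. \<Sum>a\<in>A. \<iota> (of_int (c a f + d a f) * w powi a) * M f)"
  proof -
    have "y = (\<Sum>f\<in>S. \<Sum>a\<in>A. \<iota> (of_int (c a f) * w powi a) * M f)"
      unfolding c(4) by (rule sum_support_swap[OF fin suppc]) simp
    moreover have "y' = (\<Sum>f\<in>S. \<Sum>a\<in>A. \<iota> (of_int (d a f) * w powi a) * M f)"
      unfolding d(4) by (rule sum_support_swap[OF fin suppd]) simp
    ultimately show ?thesis
      by (simp add: sum.distrib distrib_right \<iota>_hom(2) Aeps_term)
  qed
  ultimately show ?thesis
    unfolding rel_iff using fin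
    by (intro exI[of _ A] exI[of _ S] exI[of _ "\<lambda>a f. c a f + d a f"]) blast
qed

lemma rel_0: "rel P 0 0"
  unfolding rel_iff by (rule exI[of _ "{}"], rule exI[of _ "{}"]) simp

lemma rel_sum:
  assumes "\<And>i. i \<in> A \<Longrightarrow> rel P (x i) (y i)"
  shows "rel P (\<Sum>i\<in>A. x i) (\<Sum>i\<in>A. y i)"
  using assms by (induction A rule: infinite_finite_induct) (auto intro: rel_0 rel_add)

text \<open>Both frames share the matrix \<open>L\<close>, so the twist \<open>bil L f g\<close> is
  the same integer on both sides.\<close>

lemma rel_mult_gen:
  assumes "P (\<lambda>i. f i + g i)"
  shows "rel P (of_int n * t powi a * Mq f * (of_int m * t powi b * Mq g))
    (\<iota> (of_int n * w powi a) * M f * (\<iota> (of_int m * w powi b) * M g))"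
proof -
  let ?x = "of_int n * t powi a" and ?y = "of_int m * t powi b"
  have "?x * Mq f * (?y * Mq g) = ?x * (Mq f * ?y) * Mq g"
    by (simp add: mult.assoc)
  also have "Mq f * ?y = ?y * Mq f"
    by (rule Q.central[OF Q.mult_in[OF Aq_scal_of_int Q.s_in], symmetric])
  also have "?x * (?y * Mq f) * Mq g = (?x * ?y) * (Mq f * Mq g)"
    by (simp add: mult.assoc)
  also have "?x * ?y = of_int n * (t powi a * of_int m) * t powi b"
    by (simp add: mult.assoc)
  also have "t powi a * of_int m = of_int m * t powi a"
    by (rule mult_of_int_commute[symmetric])
  also have "of_int n * (of_int m * t powi a) * t powi b * (Mq f * Mq g)
      = of_int (n * m) * t powi (a + b + bil L f g) * Mq (\<lambda>i. f i + g i)"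
    by (simp add: Q.frame_mult[OF Mq_frame, of f g] Q.s_add mult.assoc)
  finally have q: "of_int n * t powi a * Mq f * (of_int m * t powi b * Mq g)
      = of_int (n * m) * t powi (a + b + bil L f g) * Mq (\<lambda>i. f i + g i)" .
  have "\<iota> (of_int n * w powi a) * M f * (\<iota> (of_int m * w powi b) * M g)
      = \<iota> (of_int n * w powi a) * (M f * \<iota> (of_int m * w powi b)) * M g"
    by (simp add: mult.assoc)
  also have "\<dots> = \<iota> (of_int n * w powi a) * \<iota> (of_int m * w powi b) * (M f * M g)"
    unfolding \<iota>_hom(4)[OF Aeps_term, of m b "M f", symmetric] by (simp add: mult.assoc)
  also have "\<dots> = \<iota> (of_int n * w powi a) * \<iota> (of_int m * w powi b) * \<iota> (w powi bil L f g) * M (\<lambda>i. f i + g i)"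
    by (simp add: E.frame_mult[OF M_frame, of f g] mult.assoc)
  also have "\<iota> (of_int n * w powi a) * \<iota> (of_int m * w powi b) * \<iota> (w powi bil L f g)
      = \<iota> (of_int n * w powi a * (of_int m * w powi b) * w powi bil L f g)"
    by (simp add: \<iota>_hom(3) Aeps_mult Aeps_term Aeps_w)
  also have "of_int n * w powi a * (of_int m * w powi b) * w powi bil L f g
      = of_int (n * m) * w powi (a + b + bil L f g)"
    using w_nonzero by (simp add: power_int_add)
  finally show ?thesis unfolding q using rel_gen[of P "\<lambda>i. f i + g i", OF assms] by (simp only:)
qed

lemma rel_mult:
  assumes P: "\<And>f g. P f \<Longrightarrow> P g \<Longrightarrow> P (\<lambda>i. f i + g i)"
    and "rel P x y" "rel P x' y'"
  shows "rel P (x * x') (y * y')"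
proof -
  obtain A S c where 1: "\<forall>f\<in>S. P f"
      "x = (\<Sum>f\<in>S. \<Sum>a\<in>A. of_int (c a f) * t powi a * Mq f)"
      "y = (\<Sum>f\<in>S. \<Sum>a\<in>A. \<iota> (of_int (c a f) * w powi a) * M f)"
    using assms(2) unfolding rel_iff by blast
  obtain A' S' c' where 2: "\<forall>f\<in>S'. P f"
      "x' = (\<Sum>f\<in>S'. \<Sum>a\<in>A'. of_int (c' a f) * t powi a * Mq f)"
      "y' = (\<Sum>f\<in>S'. \<Sum>a\<in>A'. \<iota> (of_int (c' a f) * w powi a) * M f)"
    using assms(3) unfolding rel_iff by blast
  show ?thesis
    unfolding 1(2,3) 2(2,3) sum_product
    by (intro rel_sum rel_mult_gen P) (use 1(1) 2(1) in auto)
qed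

lemma rel_mono: "rel P x y \<Longrightarrow> (\<And>f. P f \<Longrightarrow> R f) \<Longrightarrow> rel R x y"
  unfolding rel_def by blast

text \<open>Independence of the quantum monomials over the powers of \<open>t\<close> makes the
  coefficient array of \<open>x\<close> unique; this justifies the definite description in
  \<open>kappa\<close>.\<close>

lemma rel_functional:
  assumes "rel P x y" "rel P x y'"
  shows "y = y'"
proof -
  obtain c where c: "finite {(a, f). c a f \<noteq> 0}"
      "x = (\<Sum>(a, f)\<in>{(a, f). c a f \<noteq> 0}. of_int (c a f) * t powi a * Mq f)"
      "y = (\<Sum>(a, f)\<in>{(a, f). c a f \<noteq> 0}. \<iota> (of_int (c a f) * w powi a) * M f)"
    using assms(1) unfolding rel_def by blast
  obtain d where d: "finite {(a, f). d a f \<noteq> 0}"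
      "x = (\<Sum>(a, f)\<in>{(a, f). d a f \<noteq> 0}. of_int (d a f) * t powi a * Mq f)"
      "y' = (\<Sum>(a, f)\<in>{(a, f). d a f \<noteq> 0}. \<iota> (of_int (d a f) * w powi a) * M f)"
    using assms(2) unfolding rel_def by blast
  define U where "U = {(a, f). c a f \<noteq> 0} \<union> {(a, f). d a f \<noteq> 0}"
  define A where "A = fst ` U"
  define S where "S = snd ` U"
  have fin: "finite A" "finite S" using c(1) d(1) by (simp_all add: A_def S_def U_def)
  have suppc: "{(a, f). c a f \<noteq> 0} \<subseteq> A \<times> S" and suppd: "{(a, f). d a f \<noteq> 0} \<subseteq> A \<times> S"
    by (force simp: A_def S_def U_def)+
  have "x = (\<Sum>f\<in>S. \<Sum>a\<in>A. of_int (c a f) * t powi a * Mq f)"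
    unfolding c(2) by (rule sum_support_swap[OF fin suppc]) simp
  moreover have "x = (\<Sum>f\<in>S. \<Sum>a\<in>A. of_int (d a f) * t powi a * Mq f)"
    unfolding d(2) by (rule sum_support_swap[OF fin suppd]) simp
  ultimately have "(\<Sum>f\<in>S. \<Sum>a\<in>A. of_int (c a f - d a f) * t powi a * Mq f) = 0"
    by (simp add: left_diff_distrib sum_subtractf)
  then have "c a f - d a f = 0" if "a \<in> A" "f \<in> S" for a f
    using Mq_independent_sum[OF fin, of "\<lambda>a f. c a f - d a f"] that by blast
  then have "c a f = d a f" if "a \<in> A" "f \<in> S" for a f
    using that by fastforce
  moreover have "c a f = 0 \<and> d a f = 0" if "\<not> (a \<in> A \<and> f \<in> S)" for a f
    using suppc suppd that by blast
  ultimately have "c a f = d a f" for a f by metis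
  then show ?thesis unfolding c(3) d(3) by simp
qed

lemma kappa_eq:
  assumes "rel P x y"
  shows "kappa t \<iota> w Mq M x = y"
proof -
  have r: "rel (\<lambda>_. True) x y" using assms by (rule rel_mono) simp
  have "kappa t \<iota> w Mq M x = (THE y. rel (\<lambda>_. True) x y)"
    by (simp add: kappa_def rel_def)
  also have "\<dots> = y" using r rel_functional[OF _ r] by (rule the_equality)
  finally show ?thesis .
qed

lemma rel_scalar:
  assumes "P (\<lambda>_. 0)" "finite A"
  shows "rel P (\<Sum>a\<in>A. of_int (n a) * t powi a) (\<iota> (\<Sum>a\<in>A. of_int (n a) * w powi a))"
proof -
  have "rel P (\<Sum>a\<in>A. of_int (n a) * t powi a * Mq (\<lambda>_. 0)) (\<Sum>a\<in>A. \<iota> (of_int (n a) * w powi a) * M (\<lambda>_. 0))"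
    by (intro rel_sum rel_gen assms)
  moreover have "\<iota> (\<Sum>a\<in>A. of_int (n a) * w powi a) = (\<Sum>a\<in>A. \<iota> (of_int (n a) * w powi a))"
    by (intro \<iota>_sum Aeps_term)
  ultimately show ?thesis by (simp add: Q.frame_zero[OF Mq_frame] E.frame_zero[OF M_frame])
qed

lemma rel_s: "P (\<lambda>_. 0) \<Longrightarrow> rel P (t powi a) (\<iota> (w powi a))"
  using rel_scalar[of P "{a}" "\<lambda>_. 1"] by simp

lemma rel_frame: "P f \<Longrightarrow> rel P (Mq f) (M f)"
  using rel_gen[of P f 1 0] by (simp add: \<iota>_hom(1))

lemma rel_eval:
  assumes "P (\<lambda>_. 0)"
  shows "rel P (eval_int_poly p t) (\<iota> (eval_int_poly p w))"
  unfolding eval_int_poly_power_int by (intro rel_scalar assms) simp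

lemma cyclo_zero_iff: "eval_int_poly p w = 0 \<longleftrightarrow> cyclo l dvd p"
  by (rule cyclo_minimal[OF l_pos w_prim])

text \<open>\<open>t\<close> is transcendental and the cyclotomic polynomial is nonzero, being a
  divisor of \<open>monom 1 l - 1\<close>. In the division ring its value at \<open>t\<close> can
  therefore be cancelled.\<close>

lemma cyclo_t_nonzero: "eval_int_poly (cyclo l) t \<noteq> 0"
proof
  assume "eval_int_poly (cyclo l) t = 0"
  then have "(\<Sum>a\<in>int ` {..degree (cyclo l)}. of_int (coeff (cyclo l) (nat a)) * t powi a) = 0"
    by (simp only: eval_int_poly_power_int)
  then have "coeff (cyclo l) (nat (int (degree (cyclo l)))) = 0"
    by (rule t_independent[rotated]) auto
  then have "cyclo l = 0" by simp
  moreover have "cyclo l dvd monom 1 l - 1"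
    unfolding cyclo_zero_iff[symmetric] using w_prim by simp
  ultimately have "monom (1::int) l = 1" by simp
  then have "degree (monom (1::int) l) = 0" by simp
  then show False using l_pos by (simp add: degree_monom_eq)
qed

text \<open>Powers of \<open>w\<close> and \<open>t\<close> are units, so after clearing
  denominators the claim is the divisibility in \<open>cyclo_zero_iff\<close>.\<close>

lemma laurent_cyclo_division:
  assumes A: "finite A" and zero: "(\<Sum>a\<in>A. of_int (n a) * w powi a) = 0"
  shows "\<exists>q\<in>Aq_scal t. (\<Sum>a\<in>A. of_int (n a) * t powi a) = eval_int_poly (cyclo l) t * q"
proof -
  define N where "N = nat (Max (insert 0 (uminus ` A)))"
  have N: "- int N \<le> a" if "a \<in> A" for a
  proof -
    have "- a \<le> Max (insert 0 (uminus ` A))"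
      using that A by (intro Max_ge) auto
    then show ?thesis by (simp add: N_def)
  qed
  define p where "p = (\<Sum>a\<in>A. monom (n a) (nat (a + int N)))"
  have "eval_int_poly p w = 0"
    using zero laurent_sum_eq[OF w_nonzero N, of A n] w_nonzero by (simp add: p_def)
  then obtain r where r: "p = cyclo l * r" unfolding cyclo_zero_iff by auto
  have "(\<Sum>a\<in>A. of_int (n a) * t powi a) = t powi (- int N) * eval_int_poly p t"
    using laurent_sum_eq[OF t_nonzero N, of A n] by (simp add: p_def)
  also have "\<dots> = eval_int_poly (cyclo l) t * (t powi (- int N) * eval_int_poly r t)"
    unfolding r eval_int_poly_mult by (metis Q.s_comm mult.assoc)
  finally show ?thesis using Aq_scal_iff[OF t_nonzero] by blast
qed

text \<open>The division is made coefficient by coefficient and keeps the exponents in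
  \<open>S\<close>; their restriction \<open>P\<close> thus holds for the quotient, which places it
  back in the mixed torus.\<close>

lemma rel_kernel:
  assumes "rel P x 0"
  shows "\<exists>S q. finite S \<and> (\<forall>f\<in>S. P f \<and> q f \<in> Aq_scal t)
    \<and> x = eval_int_poly (cyclo l) t * (\<Sum>f\<in>S. q f * Mq f)"
proof -
  obtain A S c where fin: "finite A" "finite S" and P: "\<forall>f\<in>S. P f"
      and x: "x = (\<Sum>f\<in>S. \<Sum>a\<in>A. of_int (c a f) * t powi a * Mq f)"
      and y: "0 = (\<Sum>f\<in>S. \<Sum>a\<in>A. \<iota> (of_int (c a f) * w powi a) * M f)"
    using assms unfolding rel_iff by blast
  define d where "d = (\<lambda>f. \<Sum>a\<in>A. of_int (c a f) * w powi a)"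
  have "(\<Sum>f\<in>S. \<iota> (d f) * M f) = 0"
    unfolding y d_def by (intro sum.cong refl) (simp add: \<iota>_sum Aeps_term sum_distrib_right)
  then have d0: "d f = 0" if "f \<in> S" for f
    using that by (intro M_independent_sum[OF fin(2)]) (auto simp: d_def intro: Aeps_sum Aeps_term)
  have "\<forall>f\<in>S. \<exists>q. q \<in> Aq_scal t \<and>
      (\<Sum>a\<in>A. of_int (c a f) * t powi a) = eval_int_poly (cyclo l) t * q"
  proof
    fix f assume "f \<in> S"
    then show "\<exists>q. q \<in> Aq_scal t \<and>
        (\<Sum>a\<in>A. of_int (c a f) * t powi a) = eval_int_poly (cyclo l) t * q"
      using laurent_cyclo_division[OF fin(1), of "\<lambda>a. c a f"] d0[of f] by (auto simp: d_def)
  qed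
  then obtain q where q: "\<forall>f\<in>S. q f \<in> Aq_scal t \<and>
      (\<Sum>a\<in>A. of_int (c a f) * t powi a) = eval_int_poly (cyclo l) t * q f"
    by (rule bchoice[THEN exE])
  have "x = (\<Sum>f\<in>S. eval_int_poly (cyclo l) t * (q f * Mq f))"
    unfolding x
  proof (rule sum.cong)
    fix f assume f: "f \<in> S"
    have "(\<Sum>a\<in>A. of_int (c a f) * t powi a * Mq f) = (\<Sum>a\<in>A. of_int (c a f) * t powi a) * Mq f"
      by (simp add: sum_distrib_right)
    then show "(\<Sum>a\<in>A. of_int (c a f) * t powi a * Mq f) = eval_int_poly (cyclo l) t * (q f * Mq f)"
      using q f by (simp add: mult.assoc)
  qed simp
  then show ?thesis using fin P q by (auto simp: sum_distrib_left[symmetric])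
qed

section \<open>The mixed torus and the kernel\<close>

lemma inverse_frame:
  "inverse (Mq (unitv j)) = Mq (\<lambda>i. - unitv j i)" "inverse (M (unitv j)) = M (\<lambda>i. - unitv j i)"
proof -
  have "bil L (unitv j) (\<lambda>i. - unitv j i) = 0"
    by (simp add: bil_minus_right bil_self[OF skew])
  then show "inverse (Mq (unitv j)) = Mq (\<lambda>i. - unitv j i)" "inverse (M (unitv j)) = M (\<lambda>i. - unitv j i)"
    by (simp_all add: Q.frame_inverse[OF Mq_frame] E.frame_inverse[OF M_frame] \<iota>_hom(1))
qed

text \<open>The mixed torus consists of combinations of monomials whose exponents are nonnegative
  outside \<open>ex \<union> invs\<close>: these exponents contain those of the generators and are
  closed under addition.\<close>

lemma Tq_ge_rel:
  assumes "x \<in> Tq_ge t ex invs Mq"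
  shows "\<exists>y. rel (\<lambda>f. \<forall>i. i \<notin> ex \<union> invs \<longrightarrow> f i \<ge> 0) x y"
    (is "\<exists>y. rel ?P x y")
  using assms unfolding Tq_ge_def
proof (induction rule: gen_alg.induct)
  case (scal x)
  then obtain n :: "int \<Rightarrow> int" where n: "finite {a. n a \<noteq> 0}" "x = (\<Sum>a\<in>{a. n a \<noteq> 0}. of_int (n a) * t powi a)"
    unfolding Aq_scal_def by blast
  have "rel ?P x (\<iota> (\<Sum>a\<in>{a. n a \<noteq> 0}. of_int (n a) * w powi a))"
    unfolding n(2) by (rule rel_scalar[OF _ n(1)]) simp
  then show ?case by blast
next
  case (gen x)
  then consider j where "x = Mq (unitv j)" | j where "j \<in> ex \<union> invs" "x = Mq (\<lambda>i. - unitv j i)"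
    unfolding inverse_frame by blast
  then show ?case
  proof cases
    case 1
    have "?P (unitv j)" by (simp add: unitv_def)
    then have "rel ?P x (M (unitv j))" unfolding 1 by (rule rel_frame)
    then show ?thesis by blast
  next
    case 2
    have "?P (\<lambda>i. - unitv j i)" using 2(1) by (auto simp: unitv_def)
    then have "rel ?P x (M (\<lambda>i. - unitv j i))" unfolding 2(2) by (rule rel_frame)
    then show ?thesis by blast
  qed
next
  case (add x y)
  then obtain x' y' where "rel ?P x x'" "rel ?P y y'" by blast
  then have "rel ?P (x + y) (x' + y')" by (rule rel_add)
  then show ?case by blast
next
  case (mult x y)
  then obtain x' y' where "rel ?P x x'" "rel ?P y y'" by blast
  then have "rel ?P (x * y) (x' * y')" by (intro rel_mult) simp_all
  then show ?case by blast
qed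

lemma Mq_in_Tq_ge:
  assumes "\<And>i. i \<notin> ex \<union> invs \<Longrightarrow> f i \<ge> 0"
  shows "Mq f \<in> Tq_ge t ex invs Mq"
proof (induction f rule: int_vec_induct[where J = "ex \<union> invs"])
  case (nonneg i)
  then show ?case by (rule assms)
next
  case zero
  have "1 \<in> Aq_scal t" by (rule Q.one_in)
  then show ?case unfolding Q.frame_zero[OF Mq_frame] Tq_ge_def by (rule gen_alg.scal)
next
  case (plus f j)
  have "Mq (unitv j) \<in> Tq_ge t ex invs Mq" unfolding Tq_ge_def by (auto intro: gen_alg.gen)
  then show ?case using plus Q.s_in unfolding Q.frame_add[OF Mq_frame, of f "unitv j"] Tq_ge_def
    by (auto intro!: gen_alg.mult intro: gen_alg.scal)
next
  case (minus f j)
  have "Mq (\<lambda>i. - unitv j i) \<in> Tq_ge t ex invs Mq"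
    using minus(1) unfolding Tq_ge_def inverse_frame(1)[symmetric] by (auto intro: gen_alg.gen)
  then show ?case using minus Q.s_in
    unfolding Q.frame_add[OF Mq_frame, of f "\<lambda>i. - unitv j i"] Tq_ge_def
    by (auto intro!: gen_alg.mult intro: gen_alg.scal)
qed


lemma kappa_zero_iff:
  assumes "x \<in> Tq_ge t ex invs Mq"
  shows "kappa t \<iota> w Mq M x = 0 \<longleftrightarrow> x \<in> (\<lambda>y. eval_int_poly (cyclo l) t * y) ` Tq_ge t ex invs Mq"
proof
  assume zero: "kappa t \<iota> w Mq M x = 0"
  obtain y where "rel (\<lambda>f. \<forall>i. i \<notin> ex \<union> invs \<longrightarrow> f i \<ge> 0) x y" using Tq_ge_rel[OF assms] by blast
  then have x0: "rel (\<lambda>f. \<forall>i. i \<notin> ex \<union> invs \<longrightarrow> f i \<ge> 0) x 0" using kappa_eq zero by metis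
  obtain S q where Sq: "finite S" "\<forall>f\<in>S. (\<forall>i. i \<notin> ex \<union> invs \<longrightarrow> f i \<ge> 0) \<and> q f \<in> Aq_scal t"
      "x = eval_int_poly (cyclo l) t * (\<Sum>f\<in>S. q f * Mq f)"
    using rel_kernel[OF x0] by (elim exE conjE)
  have "q f * Mq f \<in> Tq_ge t ex invs Mq" if "f \<in> S" for f
  proof -
    have "Mq f \<in> Tq_ge t ex invs Mq" using Sq(2) that by (intro Mq_in_Tq_ge) blast
    then show ?thesis
      using Sq(2) that unfolding Tq_ge_def by (intro gen_alg.mult) (auto intro: gen_alg.scal)
  qed
  then have "(\<Sum>f\<in>S. q f * Mq f) \<in> Tq_ge t ex invs Mq"
    unfolding Tq_ge_def by (intro gen_alg_sum Q.zero_in)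
  then show "x \<in> (\<lambda>y. eval_int_poly (cyclo l) t * y) ` Tq_ge t ex invs Mq" using Sq(3) by blast
next
  assume "x \<in> (\<lambda>y. eval_int_poly (cyclo l) t * y) ` Tq_ge t ex invs Mq"
  then obtain y where y: "y \<in> Tq_ge t ex invs Mq" "x = eval_int_poly (cyclo l) t * y" by blast
  obtain y' where "rel (\<lambda>_. True) y y'"
    using Tq_ge_rel[OF y(1)] by (blast intro: rel_mono)
  moreover have "rel (\<lambda>_. True) (eval_int_poly (cyclo l) t) 0"
    using rel_eval[of "\<lambda>_. True" "cyclo l"] cyclo_zero_iff[of "cyclo l"] by simp
  ultimately have "rel (\<lambda>_. True) x (0 * y')" unfolding y(2) by (intro rel_mult) simp_all
  then show "kappa t \<iota> w Mq M x = 0" using kappa_eq by simp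
qed

section \<open>Matching seeds and cluster algebras\<close>

text \<open>The invariant of a simultaneous walk through both seed trees. Only the variables are
  related: the inverse of a mutated quantum variable need not lie in the torus where \<kappa> is
  defined.\<close>

definition linked where
  "linked D ex Mq' M' L' B' \<longleftrightarrow> (\<forall>i j. L' i j = - L' j i) \<and> compat L' B' D ex
    \<and> mult_rel (\<lambda>a. t powi a) L' Mq' \<and> Q.indep Mq'
    \<and> mult_rel (\<lambda>a. \<iota> (w powi a)) L' M' \<and> E.indep M'
    \<and> (\<forall>i. rel (\<lambda>_. True) (Mq' (unitv i)) (M' (unitv i)))"

lemma linked_nonneg:
  assumes "linked D ex Mq' M' L' B'" "\<And>i. f i \<ge> 0"
  shows "rel (\<lambda>_. True) (Mq' f) (M' f)"
proof (induction f rule: int_vec_induct[where J = "{}"])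
  case (nonneg i)
  show ?case by (rule assms(2))
next
  case zero
  then show ?case
    using assms(1) rel_s[of "\<lambda>_. True" 0] by (simp add: linked_def mult_rel_def \<iota>_hom(1))
next
  case (plus f j)
  have q: "mult_rel (\<lambda>a. t powi a) L' Mq'" and e: "mult_rel (\<lambda>a. \<iota> (w powi a)) L' M'"
    and j: "rel (\<lambda>_. True) (Mq' (unitv j)) (M' (unitv j))"
    using assms(1) by (simp_all add: linked_def)
  have f: "rel (\<lambda>_. True) (Mq' f) (M' f)" using plus by simp
  show ?case
    unfolding Q.frame_add[OF q, of f "unitv j"] E.frame_add[OF e, of f "unitv j"]
    by (intro rel_mult rel_s f j) simp_all
qed simp_all

text \<open>The exchange relation, multiplied by the old variable, expresses the new variable by old ones
  with nonnegative exponents only. As \<open>\<kappa>\<close> is defined on the new quantum variable by the Laurent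
  phenomenon, its value there is determined by cancelling the old variable.\<close>

lemma linked_mutation:
  assumes link: "linked D ex Mq' M' L' B'" and k: "k \<in> ex"
    and laurent: "rel (\<lambda>_. True) (mut_M (\<lambda>a. t powi a) L' B' k Mq' (unitv k)) y"
  shows "linked D ex (mut_M (\<lambda>a. t powi a) L' B' k Mq') (mut_M (\<lambda>a. \<iota> (w powi a)) L' B' k M')
    (mut_L L' B' k) (mut_B B' k)"
proof -
  have skew': "\<forall>i j. L' i j = - L' j i" and c: "compat L' B' D ex"
    and q: "mult_rel (\<lambda>a. t powi a) L' Mq'" "Q.indep Mq'"
    and e: "mult_rel (\<lambda>a. \<iota> (w powi a)) L' M'" "E.indep M'"
    and old: "\<And>i. rel (\<lambda>_. True) (Mq' (unitv i)) (M' (unitv i))"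
    using link unfolding linked_def by blast+
  note mq = Q.mut_M_frame[OF q(1) skew' q(2) c k]
  note me = E.mut_M_frame[OF e(1) skew' e(2) c k]
  let ?a = "\<lambda>i. - unitv k i + max (B' i k) 0" and ?b = "\<lambda>i. - unitv k i - min (B' i k) 0"
  \<comment> \<open>To be used with \<open>?a\<close> and \<open>?b\<close>: adding
    \<open>unitv k\<close> removes their only possible source of negative entries and leaves the
    positive and negative parts of column \<open>k\<close>.\<close>
  have exch: "rel (\<lambda>_. True) (Mq' f * Mq' (unitv k)) (M' f * M' (unitv k))"
    if "\<And>i. f i + unitv k i \<ge> 0" for f
    unfolding Q.frame_mult[OF q(1)] E.frame_mult[OF e(1)]
    by (intro rel_mult rel_s linked_nonneg[OF link] that) simp_all
  have "rel (\<lambda>_. True) ((Mq' ?a + Mq' ?b) * Mq' (unitv k)) ((M' ?a + M' ?b) * M' (unitv k))"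
    unfolding distrib_right by (intro rel_add exch) simp_all
  moreover have "rel (\<lambda>_. True) ((Mq' ?a + Mq' ?b) * Mq' (unitv k)) (y * M' (unitv k))"
    using laurent unfolding mq(3) by (intro rel_mult old) simp_all
  ultimately have "y * M' (unitv k) = (M' ?a + M' ?b) * M' (unitv k)"
    by (rule rel_functional[rotated])
  then have "y = M' ?a + M' ?b" using E.frame_nonzero[OF e(1)] by simp
  then have "rel (\<lambda>_. True) (mut_M (\<lambda>a. t powi a) L' B' k Mq' (unitv k))
      (mut_M (\<lambda>a. \<iota> (w powi a)) L' B' k M' (unitv k))"
    using laurent unfolding me(3) by simp
  then have "rel (\<lambda>_. True) (mut_M (\<lambda>a. t powi a) L' B' k Mq' (unitv i))
      (mut_M (\<lambda>a. \<iota> (w powi a)) L' B' k M' (unitv i))" for i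
    using mq(2)[of i] me(2)[of i] old[of i] by (cases "i = k") simp_all
  then show ?thesis
    unfolding linked_def using mut_L_skew[OF skew'] compat_mut[OF c k] mq(1,4) me(1,4) by blast
qed

lemma cluster_variable_in_cluster_alg:
  "(M', L', B') \<in> seeds s ex M0 L0 B0 \<Longrightarrow> M' (unitv i) \<in> cluster_alg C s ex invs M0 L0 B0"
  unfolding cluster_alg_def by (rule gen_alg.gen) blast

context
  fixes B :: "'n \<Rightarrow> 'n \<Rightarrow> int" and D :: "'n \<Rightarrow> int" and ex invs :: "'n set"
  assumes compat: "compat L B D ex"
    and laurent: "cluster_alg (Aq_scal t) (\<lambda>a. t powi a) ex invs Mq L B \<subseteq> Tq_ge t ex invs Mq"
begin

lemma linked_init: "linked D ex Mq M L B"
  unfolding linked_def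
  by (intro conjI allI skew[rule_format] compat Mq_frame Mq_indep M_frame M_indep rel_frame TrueI)

lemma linked_step:
  assumes "linked D ex Mq' M' L' B'" "k \<in> ex"
    and "(Mq', L', B') \<in> seeds (\<lambda>a. t powi a) ex Mq L B"
  shows "linked D ex (mut_M (\<lambda>a. t powi a) L' B' k Mq') (mut_M (\<lambda>a. \<iota> (w powi a)) L' B' k M')
    (mut_L L' B' k) (mut_B B' k)"
proof -
  have "mut_M (\<lambda>a. t powi a) L' B' k Mq' (unitv k) \<in> Tq_ge t ex invs Mq"
    using laurent cluster_variable_in_cluster_alg[OF seeds.step[OF assms(3,2)]] by blast
  then obtain y where "rel (\<lambda>_. True) (mut_M (\<lambda>a. t powi a) L' B' k Mq' (unitv k)) y"
    by (blast dest: Tq_ge_rel intro: rel_mono)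
  then show ?thesis by (rule linked_mutation[OF assms(1,2)])
qed

text \<open>The same directions are mutated on both sides, and the matrices evolve identically
  because their mutation rules do not involve the frames. This shows that \<kappa> maps into the
  root of unity cluster algebra.\<close>

lemma quantum_seed_linked:
  assumes "(Mq', L', B') \<in> seeds (\<lambda>a. t powi a) ex Mq L B"
  shows "\<exists>M'. (M', L', B') \<in> seeds (\<lambda>a. \<iota> (w powi a)) ex M L B \<and> linked D ex Mq' M' L' B'"
  using assms
proof (induction rule: seeds.induct)
  case init
  then show ?case using linked_init seeds.init by blast
next
  case (step Mq' L' B' k)
  then show ?case using linked_step seeds.step by blast
qed

text \<open>The lifting direction, for surjectivity: the quantum seed supplied by the induction
  hypothesis gives access to the Laurent phenomenon at the next mutation.\<close>

lemma root_of_unity_seed_linked: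
  assumes "(M', L', B') \<in> seeds (\<lambda>a. \<iota> (w powi a)) ex M L B"
  shows "\<exists>Mq'. (Mq', L', B') \<in> seeds (\<lambda>a. t powi a) ex Mq L B \<and> linked D ex Mq' M' L' B'"
  using assms
proof (induction rule: seeds.induct)
  case init
  then show ?case using linked_init seeds.init by blast
next
  case (step M' L' B' k)
  then show ?case using linked_step seeds.step by blast
qed

lemma quantum_cluster_alg_rel:
  assumes "x \<in> cluster_alg (Aq_scal t) (\<lambda>a. t powi a) ex invs Mq L B"
  shows "\<exists>y\<in>cluster_alg (\<iota> ` Aeps w) (\<lambda>a. \<iota> (w powi a)) ex invs M L B. rel (\<lambda>_. True) x y"
  using assms unfolding cluster_alg_def[of "Aq_scal t"]
proof (induction rule: gen_alg.induct)
  case (scal x)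
  then obtain n :: "int \<Rightarrow> int" where n: "finite {a. n a \<noteq> 0}" "x = (\<Sum>a\<in>{a. n a \<noteq> 0}. of_int (n a) * t powi a)"
    unfolding Aq_scal_def by blast
  have "rel (\<lambda>_. True) x (\<iota> (\<Sum>a\<in>{a. n a \<noteq> 0}. of_int (n a) * w powi a))"
    unfolding n(2) by (rule rel_scalar[OF _ n(1)]) simp
  moreover have "\<iota> (\<Sum>a\<in>{a. n a \<noteq> 0}. of_int (n a) * w powi a)
      \<in> cluster_alg (\<iota> ` Aeps w) (\<lambda>a. \<iota> (w powi a)) ex invs M L B"
    unfolding cluster_alg_def by (intro gen_alg.scal imageI Aeps_sum Aeps_term)
  ultimately show ?case by blast
next
  case (gen x)
  then consider Mq' L' B' i where "(Mq', L', B') \<in> seeds (\<lambda>a. t powi a) ex Mq L B" "x = Mq' (unitv i)"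
    | j where "j \<in> invs" "x = inverse (Mq (unitv j))"
    by blast
  then show ?case
  proof cases
    case 1
    obtain M' where "(M', L', B') \<in> seeds (\<lambda>a. \<iota> (w powi a)) ex M L B" "linked D ex Mq' M' L' B'"
      using quantum_seed_linked[OF 1(1)] by blast
    then show ?thesis
      unfolding 1(2) linked_def using cluster_variable_in_cluster_alg by blast
  next
    case 2
    have "inverse (M (unitv j)) \<in> cluster_alg (\<iota> ` Aeps w) (\<lambda>a. \<iota> (w powi a)) ex invs M L B"
      unfolding cluster_alg_def by (rule gen_alg.gen) (use 2 in blast)
    then show ?thesis
      unfolding 2(2) inverse_frame by (rule bexI[rotated]) (simp add: rel_frame)
  qed
next
  case (add x y)
  then show ?case using rel_add unfolding cluster_alg_def[of "\<iota> ` Aeps w"] by (blast intro: gen_alg.add)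
next
  case (mult x y)
  then obtain x' y' where
    "x' \<in> cluster_alg (\<iota> ` Aeps w) (\<lambda>a. \<iota> (w powi a)) ex invs M L B" "rel (\<lambda>_. True) x x'"
    "y' \<in> cluster_alg (\<iota> ` Aeps w) (\<lambda>a. \<iota> (w powi a)) ex invs M L B" "rel (\<lambda>_. True) y y'"
    by blast
  then show ?case unfolding cluster_alg_def[of "\<iota> ` Aeps w"]
    using rel_mult[of "\<lambda>_. True"] by (blast intro: gen_alg.mult)
qed

lemma root_of_unity_cluster_alg_rel:
  assumes "y \<in> cluster_alg (\<iota> ` Aeps w) (\<lambda>a. \<iota> (w powi a)) ex invs M L B"
  shows "\<exists>x\<in>cluster_alg (Aq_scal t) (\<lambda>a. t powi a) ex invs Mq L B. rel (\<lambda>_. True) x y"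
  using assms unfolding cluster_alg_def[of "\<iota> ` Aeps w"]
proof (induction rule: gen_alg.induct)
  case (scal y)
  then obtain p where p: "y = \<iota> (eval_int_poly p w)" by (auto simp: Aeps_iff)
  have "eval_int_poly p t \<in> Aq_scal t"
    unfolding Aq_scal_iff[OF t_nonzero] by (intro exI[of _ 0] exI[of _ p]) simp
  then have "eval_int_poly p t \<in> cluster_alg (Aq_scal t) (\<lambda>a. t powi a) ex invs Mq L B"
    unfolding cluster_alg_def by (rule gen_alg.scal)
  then show ?case unfolding p by (rule bexI[rotated]) (simp add: rel_eval)
next
  case (gen y)
  then consider M' L' B' i where "(M', L', B') \<in> seeds (\<lambda>a. \<iota> (w powi a)) ex M L B" "y = M' (unitv i)"
    | j where "j \<in> invs" "y = inverse (M (unitv j))"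
    by blast
  then show ?case
  proof cases
    case 1
    obtain Mq' where "(Mq', L', B') \<in> seeds (\<lambda>a. t powi a) ex Mq L B" "linked D ex Mq' M' L' B'"
      using root_of_unity_seed_linked[OF 1(1)] by blast
    then show ?thesis
      unfolding 1(2) linked_def using cluster_variable_in_cluster_alg by blast
  next
    case 2
    have "inverse (Mq (unitv j)) \<in> cluster_alg (Aq_scal t) (\<lambda>a. t powi a) ex invs Mq L B"
      unfolding cluster_alg_def by (rule gen_alg.gen) (use 2 in blast)
    then show ?thesis
      unfolding 2(2) inverse_frame by (rule bexI[rotated]) (simp add: rel_frame)
  qed
next
  case (add x y)
  then show ?case using rel_add unfolding cluster_alg_def[of "Aq_scal t"] by (blast intro: gen_alg.add)
next
  case (mult x y)
  then obtain x' y' where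
    "x' \<in> cluster_alg (Aq_scal t) (\<lambda>a. t powi a) ex invs Mq L B" "rel (\<lambda>_. True) x' x"
    "y' \<in> cluster_alg (Aq_scal t) (\<lambda>a. t powi a) ex invs Mq L B" "rel (\<lambda>_. True) y' y"
    by blast
  then show ?case unfolding cluster_alg_def[of "Aq_scal t"]
    using rel_mult[of "\<lambda>_. True"] by (blast intro: gen_alg.mult)
qed

lemma kappa_image:
  "kappa t \<iota> w Mq M ` cluster_alg (Aq_scal t) (\<lambda>a. t powi a) ex invs Mq L B
    = cluster_alg (\<iota> ` Aeps w) (\<lambda>a. \<iota> (w powi a)) ex invs M L B"
proof (intro equalityI subsetI)
  fix y assume "y \<in> kappa t \<iota> w Mq M ` cluster_alg (Aq_scal t) (\<lambda>a. t powi a) ex invs Mq L B"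
  then show "y \<in> cluster_alg (\<iota> ` Aeps w) (\<lambda>a. \<iota> (w powi a)) ex invs M L B"
    using quantum_cluster_alg_rel kappa_eq by blast
next
  fix y assume "y \<in> cluster_alg (\<iota> ` Aeps w) (\<lambda>a. \<iota> (w powi a)) ex invs M L B"
  then show "y \<in> kappa t \<iota> w Mq M ` cluster_alg (Aq_scal t) (\<lambda>a. t powi a) ex invs Mq L B"
    using root_of_unity_cluster_alg_rel kappa_eq by blast
qed

end

end

theorem theorem5p9:
  fixes l :: nat and w :: complex
    and \<iota> :: "complex \<Rightarrow> 'f::division_ring" and M :: "('n::finite \<Rightarrow> int) \<Rightarrow> 'f"
    and t :: "'k::division_ring" and Mq :: "('n \<Rightarrow> int) \<Rightarrow> 'k"
    and \<Lambda> B :: "'n \<Rightarrow> 'n \<Rightarrow> int" and D :: "'n \<Rightarrow> int" and ex invs :: "'n set"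
  assumes l_pos: "l > 0"
    and w_prim: "w ^ l = 1" "\<forall>m. 0 < m \<and> m < l \<longrightarrow> w ^ m \<noteq> 1"
    and skew: "\<forall>i j. \<Lambda> i j = - \<Lambda> j i"
    and eframe: "eframe \<iota> w \<Lambda> M"
    and ell_compat: "ell_compat l \<Lambda> B D ex"
    and strict: "compat \<Lambda> B D ex"
    and qframe: "qframe t \<Lambda> Mq"
    and invs_disj: "invs \<inter> ex = {}"
    and hyp: "cluster_alg (Aq_scal t) (\<lambda>a. t powi a) ex invs Mq \<Lambda> B
                \<inter> (\<lambda>y. eval_int_poly (cyclo l) t * y) ` Tq_ge t ex invs Mq
              = (\<lambda>y. eval_int_poly (cyclo l) t * y) ` cluster_alg (Aq_scal t) (\<lambda>a. t powi a) ex invs Mq \<Lambda> B"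
  shows "kappa t \<iota> w Mq M ` cluster_alg (Aq_scal t) (\<lambda>a. t powi a) ex invs Mq \<Lambda> B
           = cluster_alg (\<iota> ` Aeps w) (\<lambda>a. \<iota> (w powi a)) ex invs M \<Lambda> B
       \<and> {x \<in> cluster_alg (Aq_scal t) (\<lambda>a. t powi a) ex invs Mq \<Lambda> B. kappa t \<iota> w Mq M x = 0}
           = (\<lambda>y. eval_int_poly (cyclo l) t * y) ` cluster_alg (Aq_scal t) (\<lambda>a. t powi a) ex invs Mq \<Lambda> B"
proof -
  interpret specialization l w \<iota> M t Mq \<Lambda>
    by unfold_locales (fact l_pos w_prim skew eframe qframe)+
  let ?\<Phi> = "eval_int_poly (cyclo l) t"
  let ?A = "cluster_alg (Aq_scal t) (\<lambda>a. t powi a) ex invs Mq \<Lambda> B"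
  have laurent: "?A \<subseteq> Tq_ge t ex invs Mq"
  proof
    fix x assume "x \<in> ?A"
    then have "?\<Phi> * x \<in> (\<lambda>y. ?\<Phi> * y) ` Tq_ge t ex invs Mq" using hyp by blast
    then obtain y where "y \<in> Tq_ge t ex invs Mq" "?\<Phi> * x = ?\<Phi> * y" by blast
    then show "x \<in> Tq_ge t ex invs Mq" using cyclo_t_nonzero by simp
  qed
  have "{x \<in> ?A. kappa t \<iota> w Mq M x = 0} = ?A \<inter> (\<lambda>y. ?\<Phi> * y) ` Tq_ge t ex invs Mq"
    using kappa_zero_iff[of _ ex invs] laurent by blast
  \<comment> \<open>Image and kernel encode the isomorphism with the quotient: by
    \<open>rel_add\<close> and \<open>rel_mult\<close> the map respects sums and products on
    \<open>?A\<close>.\<close>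
  then show ?thesis using kappa_image[OF strict laurent] hyp by simp
qed

end
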